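(* Let $M$ be an $n$-dimensional real differentiable manifold and for each $x\in M$ let $\{E_i(x)\}$ and $\{E^i(x)\}$, $i=1,\dots,n$, be dual bases of $T_x(M)$ and $T_x^*(M)$. For all $x,y\in M$ let $L_{x\to y}$ be a map from the tensor algebra at $x$ into the tensor algebra at $y$. Then $(x,y)\mapsto L_{x\to y}$ is a flat linear transport over $M$ if and only if there exist real-valued functions $H^{i}{}_{j}(y,x)$ and $H_{i}{}^{j}(y,x)$ of $x,y\in M$ such that: (a) for all $x,y\in M$, all $p,q\ge 0$ and all $T=T^{i_1\ldots i_p}_{j_1\ldots j_q}E_{i_1}(x)\otimes\cdots\otimes E_{i_p}(x)\otimes E^{j_1}(x)\otimes\cdots\otimes E^{j_q}(x)\in T^{p,q}_x(M)$, $$L_{x\to y}(T)=\Bigl(\prod_{a=1}^{p}H^{k_a}{}_{i_a}(y,x)\Bigr)\Bigl(\prod_{b=1}^{q}H_{l_b}{}^{j_b}(y,x)\Bigr)T^{i_1\ldots i_p}_{j_1\ldots j_q}\,E_{k_1}(y)\otimes\cdots\otimes E_{k_p}(y)\otimes E^{l_1}(y)\otimes\cdots\otimes E^{l_q}(y);$$ (b) $H^{i}{}_{k}(y,x)H_{j}{}^{k}(y,x)=\delta^i_j$ for all $x,y\in M$ and all $i,j$; (c) there exist nondegenerate real $n\times n$ matrices $F_x$, $x\in M$, such that the matrix $\mathbf{H}(y,x):=[H^{i}{}_{j}(y,x)]$ (superscript = row index, subscript = column index) satisfies $\mathbf{H}(y,x)=F_y^{-1}F_x$ for all $x,y\in 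M$.
   Context: Repeated indices are summed from $1$ to $n$; empty products equal $1$. $T^{p,q}_x(M)$ is the space of tensors of type $(p,q)$ at $x$ (with $T^{0,0}_x(M)=\mathbb{R}$, $T^{1,0}_x(M)=T_x(M)$, $T^{0,1}_x(M)=T_x^*(M)$); the tensor algebra at $x$ is understood as consisting of the tensors of all types $(p,q)$ at $x$. A flat linear transport (of tensors) over $M$ is a map $L:(x,y)\mapsto L_{x\to y}$, $x,y\in M$, where $L_{x\to y}$ maps tensors at $x$ to tensors at $y$, such that for all $x,y,z\in M$ and all types: (i) $L_{x\to y}(T^{p,q}_x(M))\subseteq T^{p,q}_y(M)$; (ii) $L_{x\to y}(\lambda A+\mu A')=\lambda L_{x\to y}A+\mu L_{x\to y}A'$ for $\lambda,\mu\in\mathbb{R}$, $A,A'\in T^{p,q}_x(M)$; (iii) $L_{x\to y}(A_1\otimes A_2)=(L_{x\to y}A_1)\otimes(L_{x\to y}A_2)$ for tensors $A_1,A_2$ at $x$ of arbitrary types; (iv) $L_{x\to y}\circ C=C\circ L_{x\to y}$ for every contraction operator $C$; (v) $L_{y\to z}\circ L_{x\to y}=L_{x\to z}$; (vi) $L_{x\to x}=\mathrm{id}$. *)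

theory Defs
  imports "HOL-Analysis.Analysis" "HOL-Library.Function_Algebras"
begin

section \<open>Functions as a real vector space\<close>

text \<open>Tangent vectors, covectors and multilinear forms are all encoded as functions, so the
  pointwise structure makes \<^const>\<open>independent\<close>, \<^const>\<open>span\<close> and \<^const>\<open>sum\<close> available for them.\<close>

instantiation "fun" :: (type, scaleR) scaleR
begin

definition scaleR_fun :: "real \<Rightarrow> ('a \<Rightarrow> 'b) \<Rightarrow> 'a \<Rightarrow> 'b"
  where "scaleR_fun c f = (\<lambda>x. c *\<^sub>R f x)"

instance ..

end

instance "fun" :: (type, real_vector) real_vector
  by standard (simp_all add: scaleR_fun_def plus_fun_def fun_eq_iff scaleR_add_right scaleR_add_left)


section \<open>Differentiable manifolds and tangent spaces\<close>

text \<open>A chart is a pair of a domain and a coordinate map; values of the coordinate map outside the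
  domain are irrelevant.\<close>

type_synonym ('a, 'n) chart = "'a set \<times> ('a \<Rightarrow> (real, 'n) vec)"

definition C1_on :: "'a::real_normed_vector set \<Rightarrow> ('a \<Rightarrow> 'b::real_normed_vector) \<Rightarrow> bool"
  where "C1_on S f \<longleftrightarrow> (\<exists>f'. (\<forall>x\<in>S. (f has_derivative blinfun_apply (f' x)) (at x))
                              \<and> continuous_on S f')"

definition transition ::
    "('a, 'n::finite) chart \<Rightarrow> ('a, 'n) chart \<Rightarrow> real ^ 'n \<Rightarrow> real ^ 'n"
  where "transition c c' = snd c' \<circ> inv_into (fst c) (snd c)"

text \<open>\<open>differentiable_manifold X \<A>\<close>: the topological space \<open>X\<close> with the atlas \<open>\<A>\<close> is a manifold of
  dimension \<open>CARD('n)\<close>. The atlas is only required to be of class C1 and need not be maximal, so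
  manifolds of every class Ck with \<open>1 \<le> k \<le> \<infinity>\<close> are covered; neither the smoothness class nor
  maximality affects the tangent spaces below.\<close>

definition differentiable_manifold :: "'a topology \<Rightarrow> ('a, 'n::finite) chart set \<Rightarrow> bool"
  where "differentiable_manifold X \<A> \<longleftrightarrow>
    Hausdorff_space X \<and> second_countable X \<and>
    (\<Union>c\<in>\<A>. fst c) = topspace X \<and>
    (\<forall>c\<in>\<A>. openin X (fst c) \<and> open (snd c ` fst c) \<and>
       homeomorphic_map (subtopology X (fst c)) (top_of_set (snd c ` fst c)) (snd c)) \<and>
    (\<forall>c\<in>\<A>. \<forall>c'\<in>\<A>. C1_on (snd c ` (fst c \<inter> fst c')) (transition c c'))"

text \<open>A tangent vector at \<open>x\<close> assigns to every chart around \<open>x\<close> a tuple of components, and these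
  transform with the Jacobian of the change of coordinates. It is \<open>0\<close> on all other charts so that
  equality of tangent vectors is equality of functions.\<close>

type_synonym ('a, 'n) tangent_vector = "('a, 'n) chart \<Rightarrow> (real, 'n) vec"

definition tangent_space ::
    "('a, 'n::finite) chart set \<Rightarrow> 'a \<Rightarrow> ('a, 'n) tangent_vector set"
  where "tangent_space \<A> x = {v.
    (\<forall>c\<in>\<A>. \<forall>c'\<in>\<A>. x \<in> fst c \<longrightarrow> x \<in> fst c' \<longrightarrow>
        v c' = frechet_derivative (transition c c') (at (snd c x)) (v c)) \<and>
    (\<forall>c. \<not> (c \<in> \<A> \<and> x \<in> fst c) \<longrightarrow> v c = 0)}"


section \<open>Dual spaces and bases\<close>

text \<open>In this and the next section \<open>V\<close> is a linear subspace of the type \<open>'v\<close>; it will be a tangent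
  space.\<close>

definition linear_form_on :: "'v::real_vector set \<Rightarrow> ('v \<Rightarrow> real) \<Rightarrow> bool"
  where "linear_form_on V g \<longleftrightarrow>
    (\<forall>u\<in>V. \<forall>v\<in>V. g (u + v) = g u + g v) \<and> (\<forall>c. \<forall>v\<in>V. g (c *\<^sub>R v) = c * g v)"

text \<open>Forms on \<open>V\<close> are extended by \<open>0\<close> to be determined by their values on \<open>V\<close>.\<close>

definition dual_space :: "'v::real_vector set \<Rightarrow> ('v \<Rightarrow> real) set"
  where "dual_space V = {\<omega>. linear_form_on V \<omega> \<and> (\<forall>v. v \<notin> V \<longrightarrow> \<omega> v = 0)}"

definition basis_of :: "'v::real_vector set \<Rightarrow> ('n::finite \<Rightarrow> 'v) \<Rightarrow> bool"
  where "basis_of V e \<longleftrightarrow> inj e \<and> independent (range e) \<and> span (range e) = V"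

definition dual_bases ::
    "'v::real_vector set \<Rightarrow> ('n::finite \<Rightarrow> 'v) \<Rightarrow> ('n \<Rightarrow> 'v \<Rightarrow> real) \<Rightarrow> bool"
  where "dual_bases V e \<epsilon> \<longleftrightarrow> basis_of V e \<and> basis_of (dual_space V) \<epsilon> \<and>
    (\<forall>i j. \<epsilon> i (e j) = (if i = j then 1 else 0))"


section \<open>Tensors\<close>

text \<open>A tensor of type \<open>(p, q)\<close> over \<open>V\<close> is a multilinear form in \<open>p\<close> covectors and \<open>q\<close> vectors,
  given as lists, and again extended by \<open>0\<close>. It carries its type, so that in particular the
  zero tensors of different types are distinct.\<close>

datatype 'v tensor =
  Tensor (contra_rank: nat) (co_rank: nat) (form: "('v \<Rightarrow> real) list \<Rightarrow> 'v list \<Rightarrow> real")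

definition tensor_args ::
    "'v::real_vector set \<Rightarrow> nat \<Rightarrow> nat \<Rightarrow> ('v \<Rightarrow> real) list \<Rightarrow> 'v list \<Rightarrow> bool"
  where "tensor_args V p q \<omega>s vs \<longleftrightarrow>
    length \<omega>s = p \<and> set \<omega>s \<subseteq> dual_space V \<and> length vs = q \<and> set vs \<subseteq> V"

definition multilinear_form ::
    "'v::real_vector set \<Rightarrow> nat \<Rightarrow> nat \<Rightarrow> (('v \<Rightarrow> real) list \<Rightarrow> 'v list \<Rightarrow> real) \<Rightarrow> bool"
  where "multilinear_form V p q f \<longleftrightarrow>
    (\<forall>\<omega>s vs. tensor_args V p q \<omega>s vs \<longrightarrow>
       (\<forall>a<p. linear_form_on (dual_space V) (\<lambda>\<alpha>. f (\<omega>s[a := \<alpha>]) vs)) \<and>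
       (\<forall>b<q. linear_form_on V (\<lambda>v. f \<omega>s (vs[b := v])))) \<and>
    (\<forall>\<omega>s vs. \<not> tensor_args V p q \<omega>s vs \<longrightarrow> f \<omega>s vs = 0)"

definition tensors :: "'v::real_vector set \<Rightarrow> nat \<Rightarrow> nat \<Rightarrow> 'v tensor set"
  where "tensors V p q = {Tensor p q f |f. multilinear_form V p q f}"

definition tensor_algebra :: "'v::real_vector set \<Rightarrow> 'v tensor set"
  where "tensor_algebra V = (\<Union>p q. tensors V p q)"

text \<open>The canonical embeddings of the reals, of \<open>V\<close> and of its dual as the tensors of type
  \<open>(0, 0)\<close>, \<open>(1, 0)\<close> and \<open>(0, 1)\<close>; a vector acts on covectors by evaluation.\<close>

definition scalar_tensor :: "real \<Rightarrow> 'v tensor"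
  where "scalar_tensor r = Tensor 0 0 (\<lambda>\<omega>s vs. if \<omega>s = [] \<and> vs = [] then r else 0)"

definition vector_tensor :: "'v::real_vector set \<Rightarrow> 'v \<Rightarrow> 'v tensor"
  where "vector_tensor V v =
    Tensor 1 0 (\<lambda>\<omega>s vs. if tensor_args V 1 0 \<omega>s vs then (hd \<omega>s) v else 0)"

definition covector_tensor :: "'v::real_vector set \<Rightarrow> ('v \<Rightarrow> real) \<Rightarrow> 'v tensor"
  where "covector_tensor V \<omega> =
    Tensor 0 1 (\<lambda>\<omega>s vs. if tensor_args V 0 1 \<omega>s vs then \<omega> (hd vs) else 0)"

text \<open>\<open>lincomb l A m A'\<close> is meant for tensors \<open>A\<close>, \<open>A'\<close> of one and the same type.\<close>

definition lincomb :: "real \<Rightarrow> 'v tensor \<Rightarrow> real \<Rightarrow> 'v tensor \<Rightarrow> 'v tensor"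
  where "lincomb l A m A' =
    Tensor (contra_rank A) (co_rank A) (l *\<^sub>R form A + m *\<^sub>R form A')"

definition tensor_prod :: "'v tensor \<Rightarrow> 'v tensor \<Rightarrow> 'v tensor"  (infixr "\<otimes>\<^sub>t" 70)
  where "A \<otimes>\<^sub>t B = Tensor (contra_rank A + contra_rank B) (co_rank A + co_rank B)
    (\<lambda>\<omega>s vs. form A (take (contra_rank A) \<omega>s) (take (co_rank A) vs) *
              form B (drop (contra_rank A) \<omega>s) (drop (co_rank A) vs))"

definition insert_at :: "nat \<Rightarrow> 'b \<Rightarrow> 'b list \<Rightarrow> 'b list"
  where "insert_at k z zs = take k zs @ z # drop k zs"

text \<open>Contraction of the upper slot \<open>r\<close> with the lower slot \<open>s\<close> (counted from \<open>0\<close>) of a tensor: the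
  sum, over a basis of \<open>V\<close>, of the values with a basis vector \<open>b\<close> in the lower slot and the dual
  basis element, i.e. the \<open>b\<close>-coordinate function, in the upper slot. For finite-dimensional \<open>V\<close>
  the result does not depend on the choice of the basis.\<close>

definition contraction :: "'v::real_vector set \<Rightarrow> nat \<Rightarrow> nat \<Rightarrow> 'v tensor \<Rightarrow> 'v tensor"
  where "contraction V r s A =
    (let B = (SOME B. independent B \<and> span B = V);
         coord = (\<lambda>b v. if v \<in> V then representation B v b else 0);
         p = contra_rank A - 1; q = co_rank A - 1
     in Tensor p q (\<lambda>\<omega>s vs. if tensor_args V p q \<omega>s vs
          then \<Sum>b\<in>B. form A (insert_at r (coord b) \<omega>s) (insert_at s b vs) else 0))"

text \<open>The products of basis elements
  \<open>e i\<^sub>1 \<otimes> \<dots> \<otimes> e i\<^sub>p \<otimes> \<epsilon> j\<^sub>1 \<otimes> \<dots> \<otimes> \<epsilon> j\<^sub>q\<close>, and the tensor with given components with respect to them;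
  multi-indices are lists of indices. The empty product is the scalar \<open>1\<close>.\<close>

definition basis_tensor ::
    "'v::real_vector set \<Rightarrow> ('n \<Rightarrow> 'v) \<Rightarrow> ('n \<Rightarrow> 'v \<Rightarrow> real) \<Rightarrow> 'n list \<Rightarrow> 'n list \<Rightarrow> 'v tensor"
  where "basis_tensor V e \<epsilon> is js =
    foldr (\<otimes>\<^sub>t) (map (\<lambda>i. vector_tensor V (e i)) is @ map (\<lambda>j. covector_tensor V (\<epsilon> j)) js)
      (scalar_tensor 1)"

definition multi_indices :: "nat \<Rightarrow> 'n list set"
  where "multi_indices p = {is. length is = p}"

definition tensor_of_components ::
    "'v::real_vector set \<Rightarrow> ('n::finite \<Rightarrow> 'v) \<Rightarrow> ('n \<Rightarrow> 'v \<Rightarrow> real) \<Rightarrow> nat \<Rightarrow> nat \<Rightarrow>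
     ('n list \<Rightarrow> 'n list \<Rightarrow> real) \<Rightarrow> 'v tensor"
  where "tensor_of_components V e \<epsilon> p q T =
    Tensor p q (\<Sum>is\<in>multi_indices p. \<Sum>js\<in>multi_indices q. T is js *\<^sub>R form (basis_tensor V e \<epsilon> is js))"


section \<open>Flat linear transports\<close>

type_synonym ('a, 'n) transport_map =
  "'a \<Rightarrow> 'a \<Rightarrow> ('a, 'n) tangent_vector tensor \<Rightarrow> ('a, 'n) tangent_vector tensor"

text \<open>\<open>L x y\<close> matters only for points \<open>x\<close>, \<open>y\<close> of the manifold and on tensors at \<open>x\<close>.\<close>

definition flat_linear_transport ::
    "'a topology \<Rightarrow> ('a, 'n::finite) chart set \<Rightarrow> ('a, 'n) transport_map \<Rightarrow> bool"
  where "flat_linear_transport X \<A> L \<longleftrightarrow>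
    (let M = topspace X; T = tangent_space \<A> in
      (\<forall>x\<in>M. \<forall>y\<in>M. L x y ` tensor_algebra (T x) \<subseteq> tensor_algebra (T y)) \<and>
      (\<forall>x\<in>M. \<forall>y\<in>M. \<forall>p q. L x y ` tensors (T x) p q \<subseteq> tensors (T y) p q) \<and>
      (\<forall>x\<in>M. \<forall>y\<in>M. \<forall>p q. \<forall>A\<in>tensors (T x) p q. \<forall>A'\<in>tensors (T x) p q. \<forall>l m.
         L x y (lincomb l A m A') = lincomb l (L x y A) m (L x y A')) \<and>
      (\<forall>x\<in>M. \<forall>y\<in>M. \<forall>A\<in>tensor_algebra (T x). \<forall>B\<in>tensor_algebra (T x).
         L x y (A \<otimes>\<^sub>t B) = L x y A \<otimes>\<^sub>t L x y B) \<and>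
      (\<forall>x\<in>M. \<forall>y\<in>M. \<forall>p q. \<forall>r\<le>p. \<forall>s\<le>q. \<forall>A\<in>tensors (T x) (Suc p) (Suc q).
         L x y (contraction (T x) r s A) = contraction (T y) r s (L x y A)) \<and>
      (\<forall>x\<in>M. \<forall>y\<in>M. \<forall>z\<in>M. \<forall>A\<in>tensor_algebra (T x). L y z (L x y A) = L x z A) \<and>
      (\<forall>x\<in>M. \<forall>A\<in>tensor_algebra (T x). L x x A = A))"

end

theory Submission
  imports Defs
begin

text \<open>A tensor is determined by its components, and a tensor of components is a linear combination of
  products of basis vectors and basis covectors. A flat linear transport respects linear combinations
  and products, so it is determined by the matrices \<open>H\<close> and \<open>H'\<close> of its action on vectors and on
  covectors; the one delicate point is that it fixes scalars, which needs its invertibility. It also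
  respects the contraction of a vector with a covector, hence \<open>H'\<close> is contragredient to \<open>H\<close>. The
  composition law makes \<open>H\<close> a cocycle, \<open>H(z,y) H(y,x) = H(z,x)\<close> and \<open>H(x,x) = 1\<close>, and a cocycle of
  invertible matrices splits as \<open>F\<^sub>y\<^sup>-\<^sup>1 F\<^sub>x\<close>: compare every point with a fixed one
  (\<open>matrices_of_flat_linear_transport\<close>, \<open>cocycle_factorization\<close>).

  Conversely, let \<open>L\<close> be given in components by such matrices. Then it is the natural action on
  tensors of the linear isomorphisms that the matrices define between the tangent spaces: the
  transported tensor takes on given arguments the value that the original tensor takes on these
  arguments moved back (\<open>is_pullback_components\<close>). This description has no components in it, and the
  axioms of a transport become evident, the composition law by the cocycle property
  (\<open>matrix_cocycle\<close>). Only contractions need an argument. They are defined with an arbitrarily chosen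
  basis, and a linear isomorphism does not carry the basis chosen at one point to the one chosen at
  another; but a contraction is a trace and does not depend on the basis
  (\<open>trace_independent_of_coordinates\<close>, \<open>contraction_eq\<close>).\<close>


section \<open>Multilinear expansion\<close>

lemma finite_multi_indices [simp]: "finite (multi_indices p :: 'n::finite list set)"
  using finite_lists_length_eq[of "UNIV :: 'n set" p] by (simp add: multi_indices_def)

lemma multi_indices_0 [simp]: "multi_indices 0 = {[]}"
  by (auto simp: multi_indices_def)

lemma sum_multi_indices_Suc:
  fixes h :: "'n::finite list \<Rightarrow> 'b::comm_monoid_add"
  shows "(\<Sum>is\<in>multi_indices (Suc p). h is) = (\<Sum>i\<in>UNIV. \<Sum>is\<in>multi_indices p. h (i # is))"
proof -
  have "multi_indices (Suc p) = (\<lambda>(i, is). i # is) ` (UNIV \<times> (multi_indices p :: 'n list set))"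
    by (auto simp: multi_indices_def length_Suc_conv image_iff)
  moreover have "inj_on (\<lambda>(i, is). i # is) (UNIV \<times> (multi_indices p :: 'n list set))"
    by (auto simp: inj_on_def)
  ultimately show ?thesis
    by (simp add: sum.reindex sum.cartesian_product case_prod_unfold)
qed

text \<open>This distributive law is what produces the products of matrix entries in the components of a
  transported tensor.\<close>

lemma prod_sum_multi_indices:
  fixes f :: "nat \<Rightarrow> 'n::finite \<Rightarrow> 'b::comm_semiring_1"
  shows "(\<Prod>a<p. \<Sum>k\<in>UNIV. f a k) = (\<Sum>ks\<in>multi_indices p. \<Prod>a<p. f a (ks ! a))"
proof (induction p arbitrary: f)
  case (Suc p)
  show ?case
    by (simp only: prod.lessThan_Suc_shift Suc.IH sum_multi_indices_Suc sum_product
        nth_Cons_0 nth_Cons_Suc comp_def)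
qed simp

lemma sum_fun_apply: "(\<Sum>i\<in>I. f i) x = (\<Sum>i\<in>I. f i x)"
  by (induction I rule: infinite_finite_induct) (simp_all add: zero_fun_def)

lemma scaleR_fun_apply [simp]: "(c *\<^sub>R f) x = c *\<^sub>R f x"
  by (simp add: scaleR_fun_def)

lemma subspace_dual_space: "subspace (dual_space V)"
  by (auto simp: subspace_def dual_space_def linear_form_on_def algebra_simps)

lemma linear_form_on_0: "subspace U \<Longrightarrow> linear_form_on U g \<Longrightarrow> g 0 = 0"
  unfolding linear_form_on_def by (metis mult_zero_left scaleR_zero_left subspace_0)

lemma linear_form_on_sum:
  assumes "subspace U" "linear_form_on U g" "\<And>i. i \<in> I \<Longrightarrow> u i \<in> U"
  shows "g (\<Sum>i\<in>I. c i *\<^sub>R u i) = (\<Sum>i\<in>I. c i * g (u i))"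
  using assms(3)
proof (induction I rule: infinite_finite_induct)
  case (insert i I)
  have "(\<Sum>i\<in>I. c i *\<^sub>R u i) \<in> U" "c i *\<^sub>R u i \<in> U" "u i \<in> U"
    using insert.prems assms(1) by (auto intro!: subspace_sum subspace_scale)
  then show ?case using insert assms(2) by (simp add: linear_form_on_def)
qed (simp_all add: linear_form_on_0[OF assms(1,2)])

text \<open>Expanding one argument at a time turns a multilinear function into a sum over multi-indices of
  its values on basis lists. Stating this for a single list of arguments, with abstract coefficient
  functions \<open>c\<close>, lets the same lemma serve the covector slots and the vector slots of a tensor.\<close>

lemma multilinear_expansion:
  fixes b :: "'n::finite \<Rightarrow> 'u::real_vector"
  assumes U: "subspace U" and b: "\<And>i. b i \<in> U"
    and resolution: "\<And>u. u \<in> U \<Longrightarrow> (\<Sum>i\<in>UNIV. c i u *\<^sub>R b i) = u"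
    and multilinear: "\<And>us a. length us = p \<Longrightarrow> set us \<subseteq> U \<Longrightarrow> a < p \<Longrightarrow>
      linear_form_on U (\<lambda>u. g (us[a := u]))"
    and us: "length us = p" "set us \<subseteq> U"
  shows "g us = (\<Sum>is\<in>multi_indices p. (\<Prod>a<p. c (is ! a) (us ! a)) * g (map b is))"
  using multilinear us
proof (induction p arbitrary: g us)
  case 0
  then show ?case by simp
next
  case (Suc p)
  obtain u us' where us: "us = u # us'" using Suc.prems(2) by (cases us) auto
  have u: "u \<in> U" and us': "length us' = p" "set us' \<subseteq> U"
    using Suc.prems us by auto
  have lin: "linear_form_on U (\<lambda>u. g (u # us'))"
    using Suc.prems(1)[of us 0] Suc.prems(2,3) us by simp
  have tail: "g (b i # us') =
      (\<Sum>is\<in>multi_indices p. (\<Prod>a<p. c (is ! a) (us' ! a)) * g (b i # map b is))" for i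
  proof (rule Suc.IH[where g = "\<lambda>vs. g (b i # vs)"])
    fix vs a assume "length vs = p" "set vs \<subseteq> U" "a < p"
    then show "linear_form_on U (\<lambda>u. g (b i # vs[a := u]))"
      using Suc.prems(1)[of "b i # vs" "Suc a"] b by simp
  qed (use us' in auto)
  have "g us = g ((\<Sum>i\<in>UNIV. c i u *\<^sub>R b i) # us')"
    using resolution[OF u] us by simp
  also have "\<dots> = (\<Sum>i\<in>UNIV. c i u * g (b i # us'))"
    by (rule linear_form_on_sum[OF U lin]) (rule b)
  finally show ?case
    unfolding tail sum_multi_indices_Suc us
    by (simp add: sum_distrib_left mult.assoc prod.lessThan_Suc_shift del: prod.lessThan_Suc)
qed


section \<open>Coordinate systems and contractions\<close>

text \<open>The covectors \<open>\<alpha> i\<close> and vectors \<open>a i\<close> resolve the identity of \<open>V\<close>. Asking only for this, and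
  not for dual bases, keeps all index sets on the same footing: the hidden basis in the definition of
  a contraction, a given pair of dual bases, and the image of such a pair under a linear map.\<close>

definition coordinate_system ::
    "'v::real_vector set \<Rightarrow> 'i set \<Rightarrow> ('i \<Rightarrow> 'v \<Rightarrow> real) \<Rightarrow> ('i \<Rightarrow> 'v) \<Rightarrow> bool"
  where "coordinate_system V I \<alpha> a \<longleftrightarrow> finite I \<and> (\<forall>i\<in>I. \<alpha> i \<in> dual_space V \<and> a i \<in> V) \<and>
    (\<forall>v\<in>V. (\<Sum>i\<in>I. \<alpha> i v *\<^sub>R a i) = v)"

text \<open>A resolution of the identity of \<open>V\<close> dualizes to one of its dual space.\<close>

lemma coordinate_system_covector:
  assumes "subspace V" "coordinate_system V I \<alpha> a" "\<omega> \<in> dual_space V"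
  shows "(\<Sum>i\<in>I. \<omega> (a i) *\<^sub>R \<alpha> i) = \<omega>"
proof
  fix v
  show "(\<Sum>i\<in>I. \<omega> (a i) *\<^sub>R \<alpha> i) v = \<omega> v"
  proof (cases "v \<in> V")
    case True
    have "\<omega> v = \<omega> (\<Sum>i\<in>I. \<alpha> i v *\<^sub>R a i)"
      using assms(2) True by (simp add: coordinate_system_def)
    also have "\<dots> = (\<Sum>i\<in>I. \<alpha> i v * \<omega> (a i))"
      using assms by (intro linear_form_on_sum[of V]) (auto simp: coordinate_system_def dual_space_def)
    finally show ?thesis by (simp add: sum_fun_apply mult.commute)
  next
    case False
    then show ?thesis using assms by (auto simp: sum_fun_apply coordinate_system_def dual_space_def)
  qed
qed

text \<open>A bilinear form has a trace: expand each \<open>\<alpha> i\<close> in the \<open>\<beta> j\<close>, move the coefficients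
  \<open>\<alpha> i (b j)\<close> to the vector slot, and recognise there the expansion of \<open>b j\<close> in the \<open>a i\<close>.\<close>

lemma trace_independent_of_coordinates:
  assumes V: "subspace V"
    and "coordinate_system V I \<alpha> a" "coordinate_system V J \<beta> b"
    and lin1: "\<And>v. v \<in> V \<Longrightarrow> linear_form_on (dual_space V) (\<lambda>\<omega>. f \<omega> v)"
    and lin2: "\<And>\<omega>. \<omega> \<in> dual_space V \<Longrightarrow> linear_form_on V (f \<omega>)"
  shows "(\<Sum>i\<in>I. f (\<alpha> i) (a i)) = (\<Sum>j\<in>J. f (\<beta> j) (b j))"
proof -
  have mem: "\<And>i. i \<in> I \<Longrightarrow> \<alpha> i \<in> dual_space V" "\<And>i. i \<in> I \<Longrightarrow> a i \<in> V"
    "\<And>j. j \<in> J \<Longrightarrow> \<beta> j \<in> dual_space V" "\<And>j. j \<in> J \<Longrightarrow> b j \<in> V"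
    using assms(2,3) by (auto simp: coordinate_system_def)
  have "(\<Sum>i\<in>I. f (\<alpha> i) (a i)) = (\<Sum>i\<in>I. f (\<Sum>j\<in>J. \<alpha> i (b j) *\<^sub>R \<beta> j) (a i))"
    by (intro sum.cong refl) (simp add: coordinate_system_covector[OF V assms(3)] mem)
  also have "\<dots> = (\<Sum>i\<in>I. \<Sum>j\<in>J. \<alpha> i (b j) * f (\<beta> j) (a i))"
    by (intro sum.cong refl linear_form_on_sum[OF subspace_dual_space lin1] mem)
  also have "\<dots> = (\<Sum>j\<in>J. \<Sum>i\<in>I. \<alpha> i (b j) * f (\<beta> j) (a i))"
    by (rule sum.swap)
  also have "\<dots> = (\<Sum>j\<in>J. f (\<beta> j) (\<Sum>i\<in>I. \<alpha> i (b j) *\<^sub>R a i))"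
    by (intro sum.cong refl linear_form_on_sum[OF V lin2, symmetric] mem)
  also have "\<dots> = (\<Sum>j\<in>J. f (\<beta> j) (b j))"
    using assms(2) mem by (intro sum.cong refl) (simp add: coordinate_system_def)
  finally show ?thesis .
qed

lemma coordinate_system_representation:
  assumes "independent B" "finite B"
  shows "coordinate_system (span B) B (\<lambda>b v. if v \<in> span B then representation B v b else 0) (\<lambda>b. b)"
  unfolding coordinate_system_def dual_space_def linear_form_on_def
  using assms sum_representation_eq[OF assms(1) _ assms(2) order_refl]
  by (auto simp: representation_add representation_scale span_add span_scale span_base)

lemma length_insert_at [simp]: "length (insert_at k z zs) = Suc (length zs)"
  by (simp add: insert_at_def)

lemma set_insert_at [simp]: "set (insert_at k z zs) = insert z (set zs)"
proof -
  have "set zs = set (take k zs) \<union> set (drop k zs)"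
    by (metis append_take_drop_id set_append)
  then show ?thesis by (auto simp: insert_at_def)
qed

lemma map_insert_at: "map f (insert_at k z zs) = insert_at k (f z) (map f zs)"
  by (simp add: insert_at_def take_map drop_map)

lemma insert_at_update: "k \<le> length zs \<Longrightarrow> (insert_at k z zs)[k := z'] = insert_at k z' zs"
  by (simp add: insert_at_def list_update_append)

lemma insert_at_of_update:
  "k \<le> length zs \<Longrightarrow> a < length zs \<Longrightarrow>
   insert_at k z (zs[a := y]) = (insert_at k z zs)[(if a < k then a else Suc a) := y]"
  by (auto simp: insert_at_def nth_list_update nth_append nth_Cons intro!: nth_equalityI
      split: nat.splits)

lemma tensor_args_insert_at:
  assumes "tensor_args V p q \<omega>s vs" "\<alpha> \<in> dual_space V" "v \<in> V"
  shows "tensor_args V (Suc p) (Suc q) (insert_at r \<alpha> \<omega>s) (insert_at s v vs)"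
  using assms by (simp add: tensor_args_def)

lemma linear_insert_at_covector:
  assumes "multilinear_form V (Suc p) q f" "tensor_args V p q \<omega>s vs" "r \<le> p"
  shows "linear_form_on (dual_space V) (\<lambda>\<omega>. f (insert_at r \<omega> \<omega>s) vs)"
proof -
  have "tensor_args V (Suc p) q (insert_at r 0 \<omega>s) vs"
    using assms(2) subspace_0[OF subspace_dual_space, of V] by (simp add: tensor_args_def)
  then have "linear_form_on (dual_space V) (\<lambda>\<omega>. f ((insert_at r 0 \<omega>s)[r := \<omega>]) vs)"
    using assms(1,3) unfolding multilinear_form_def by auto
  then show ?thesis using assms(2,3) by (simp add: insert_at_update tensor_args_def)
qed

lemma linear_insert_at_vector:
  assumes "subspace V" "multilinear_form V p (Suc q) f" "tensor_args V p q \<omega>s vs" "s \<le> q"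
  shows "linear_form_on V (\<lambda>v. f \<omega>s (insert_at s v vs))"
proof -
  have "tensor_args V p (Suc q) \<omega>s (insert_at s 0 vs)"
    using assms(3) subspace_0[OF assms(1)] by (simp add: tensor_args_def)
  then have "linear_form_on V (\<lambda>v. f \<omega>s ((insert_at s 0 vs)[s := v]))"
    using assms(2,4) unfolding multilinear_form_def by auto
  then show ?thesis using assms(3,4) by (simp add: insert_at_update tensor_args_def)
qed

text \<open>The arbitrarily chosen basis behind a contraction can be exchanged for any coordinate system,
  because a contraction is the trace of the bilinear form in the two contracted slots.\<close>

lemma contraction_eq:
  assumes V: "subspace V" and cs: "coordinate_system V I \<alpha> a"
    and A: "A \<in> tensors V (Suc p) (Suc q)" and rs: "r \<le> p" "s \<le> q"
  shows "contraction V r s A = Tensor p q (\<lambda>\<omega>s vs. if tensor_args V p q \<omega>s vs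
    then \<Sum>i\<in>I. form A (insert_at r (\<alpha> i) \<omega>s) (insert_at s (a i) vs) else 0)"
proof -
  define B where "B = (SOME B. independent B \<and> span B = V)"
  obtain B0 where "B0 \<subseteq> V" "independent B0" "V \<subseteq> span B0" using basis_exists .
  then have "independent B0 \<and> span B0 = V"
    using V by (meson span_minimal subset_antisym)
  then have B: "independent B" "span B = V"
    unfolding B_def by (metis (mono_tags, lifting) someI)+
  have "V \<subseteq> span (a ` I)"
  proof
    fix v assume "v \<in> V"
    then have "v = (\<Sum>i\<in>I. \<alpha> i v *\<^sub>R a i)" using cs by (simp add: coordinate_system_def)
    also have "\<dots> \<in> span (a ` I)" by (intro span_sum span_scale span_base) auto
    finally show "v \<in> span (a ` I)" .
  qed
  then have "finite B"
    using independent_span_bound[of "a ` I" B] B cs span_superset[of B]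
    by (auto simp: coordinate_system_def)
  then have csB: "coordinate_system V B (\<lambda>b v. if v \<in> V then representation B v b else 0) (\<lambda>b. b)"
    using coordinate_system_representation B by blast
  obtain f where f: "A = Tensor (Suc p) (Suc q) f" "multilinear_form V (Suc p) (Suc q) f"
    using A by (auto simp: tensors_def)
  have "(\<Sum>b\<in>B. f (insert_at r (\<lambda>v. if v \<in> V then representation B v b else 0) \<omega>s) (insert_at s b vs))
      = (\<Sum>i\<in>I. f (insert_at r (\<alpha> i) \<omega>s) (insert_at s (a i) vs))"
    if args: "tensor_args V p q \<omega>s vs" for \<omega>s vs
  proof (rule trace_independent_of_coordinates[OF V csB cs])
    fix v assume "v \<in> V"
    then have "tensor_args V p (Suc q) \<omega>s (insert_at s v vs)"
      using args by (simp add: tensor_args_def)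
    then show "linear_form_on (dual_space V) (\<lambda>\<omega>. f (insert_at r \<omega> \<omega>s) (insert_at s v vs))"
      by (rule linear_insert_at_covector[OF f(2) _ rs(1)])
  next
    fix \<omega> assume "\<omega> \<in> dual_space V"
    then have "tensor_args V (Suc p) q (insert_at r \<omega> \<omega>s) vs"
      using args by (simp add: tensor_args_def)
    then show "linear_form_on V (\<lambda>v. f (insert_at r \<omega> \<omega>s) (insert_at s v vs))"
      by (rule linear_insert_at_vector[OF V f(2) _ rs(2)])
  qed
  then show ?thesis
    unfolding contraction_def Let_def B_def[symmetric] by (auto simp: f(1) fun_eq_iff)
qed


section \<open>Closure properties of the tensor spaces\<close>

lemma multilinear_form_sum:
  assumes "\<And>i. i \<in> I \<Longrightarrow> multilinear_form V p q (f i)"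
  shows "multilinear_form V p q (\<Sum>i\<in>I. c i *\<^sub>R f i)"
  using assms
  unfolding multilinear_form_def linear_form_on_def
  by (auto simp: sum_fun_apply sum.distrib sum_distrib_left algebra_simps intro!: sum.cong sum.neutral)

lemma tensors_iff:
  "A \<in> tensors V p q \<longleftrightarrow> contra_rank A = p \<and> co_rank A = q \<and> multilinear_form V p q (form A)"
  by (cases A) (auto simp: tensors_def)

lemma multilinear_form_covector:
  "multilinear_form V p q f \<Longrightarrow> tensor_args V p q \<omega>s vs \<Longrightarrow> a < p \<Longrightarrow>
    linear_form_on (dual_space V) (\<lambda>\<alpha>. f (\<omega>s[a := \<alpha>]) vs)"
  by (simp add: multilinear_form_def)

lemma multilinear_form_vector:
  "multilinear_form V p q f \<Longrightarrow> tensor_args V p q \<omega>s vs \<Longrightarrow> b < q \<Longrightarrow>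
    linear_form_on V (\<lambda>v. f \<omega>s (vs[b := v]))"
  by (simp add: multilinear_form_def)

lemma tensors_subset_algebra: "A \<in> tensors V p q \<Longrightarrow> A \<in> tensor_algebra V"
  by (auto simp: tensor_algebra_def)

lemma tensor_eqI:
  assumes "A \<in> tensors V p q" "B \<in> tensors V p q"
    and "\<And>\<omega>s vs. tensor_args V p q \<omega>s vs \<Longrightarrow> form A \<omega>s vs = form B \<omega>s vs"
  shows "A = B"
proof -
  have "form A \<omega>s vs = form B \<omega>s vs" for \<omega>s vs
    using assms by (cases "tensor_args V p q \<omega>s vs") (auto simp: tensors_iff multilinear_form_def)
  then show ?thesis using assms(1,2) by (intro tensor.expand) (auto simp: tensors_iff)
qed

lemma sum_tensors:
  assumes "\<And>i. i \<in> I \<Longrightarrow> A i \<in> tensors V p q"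
  shows "Tensor p q (\<Sum>i\<in>I. c i *\<^sub>R form (A i)) \<in> tensors V p q"
  using assms by (simp add: tensors_iff multilinear_form_sum)

lemma lincomb_tensors:
  assumes "A \<in> tensors V p q" "B \<in> tensors V p q"
  shows "lincomb l A m B \<in> tensors V p q"
  using assms unfolding tensors_iff multilinear_form_def linear_form_on_def lincomb_def
  by (auto simp: algebra_simps)

lemma scalar_tensor_tensors: "scalar_tensor r \<in> tensors V 0 0"
  by (auto simp: scalar_tensor_def tensors_iff multilinear_form_def tensor_args_def)

lemma vector_tensor_tensors: "v \<in> V \<Longrightarrow> vector_tensor V v \<in> tensors V 1 0"
  using subspace_dual_space[of V]
  by (auto simp: vector_tensor_def tensors_iff multilinear_form_def tensor_args_def
      linear_form_on_def length_Suc_conv subspace_def)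

lemma covector_tensor_tensors:
  "subspace V \<Longrightarrow> \<omega> \<in> dual_space V \<Longrightarrow> covector_tensor V \<omega> \<in> tensors V 0 1"
  by (auto simp: covector_tensor_def tensors_iff multilinear_form_def tensor_args_def
      linear_form_on_def length_Suc_conv subspace_def dual_space_def)

lemma tensor_args_append:
  assumes "tensor_args V p q (take p \<omega>s) (take q vs)" "tensor_args V p' q' (drop p \<omega>s) (drop q vs)"
  shows "tensor_args V (p + p') (q + q') \<omega>s vs"
proof -
  have \<omega>s: "\<omega>s = take p \<omega>s @ drop p \<omega>s" and vs: "vs = take q vs @ drop q vs"
    by simp_all
  show ?thesis
    using assms by (subst \<omega>s, subst vs) (simp only: tensor_args_def length_append set_append, auto)
qed

lemma tensor_args_take_drop:
  assumes "tensor_args V (p + p') (q + q') \<omega>s vs"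
  shows "tensor_args V p q (take p \<omega>s) (take q vs)" "tensor_args V p' q' (drop p \<omega>s) (drop q vs)"
  using assms by (auto simp: tensor_args_def dest: in_set_takeD in_set_dropD)

lemma linear_form_on_cmult: "linear_form_on U g \<Longrightarrow> linear_form_on U (\<lambda>u. c * g u)"
  "linear_form_on U g \<Longrightarrow> linear_form_on U (\<lambda>u. g u * c)"
  by (auto simp: linear_form_on_def algebra_simps)

lemma tensor_prod_tensors:
  assumes "A \<in> tensors V p q" "B \<in> tensors V p' q'"
  shows "A \<otimes>\<^sub>t B \<in> tensors V (p + p') (q + q')"
proof -
  obtain f g where f: "A = Tensor p q f" "multilinear_form V p q f"
    and g: "B = Tensor p' q' g" "multilinear_form V p' q' g"
    using assms by (auto simp: tensors_def)
  have "multilinear_form V (p + p') (q + q')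
    (\<lambda>\<omega>s vs. f (take p \<omega>s) (take q vs) * g (drop p \<omega>s) (drop q vs))"
    unfolding multilinear_form_def
  proof (intro conjI allI impI)
    fix \<omega>s vs a assume args: "tensor_args V (p + p') (q + q') \<omega>s vs" and a: "a < p + p'"
    note parts = tensor_args_take_drop[OF args]
    show "linear_form_on (dual_space V) (\<lambda>\<alpha>. f (take p (\<omega>s[a := \<alpha>])) (take q vs) *
        g (drop p (\<omega>s[a := \<alpha>])) (drop q vs))"
    proof (cases "a < p")
      case True
      then show ?thesis using f(2) parts(1)
        by (simp add: take_update_swap drop_update_cancel multilinear_form_def linear_form_on_cmult)
    next
      case False
      then show ?thesis using g(2) parts(2) a
        by (simp add: take_update_cancel drop_update_swap multilinear_form_def linear_form_on_cmult)
    qed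
  next
    fix \<omega>s vs b assume args: "tensor_args V (p + p') (q + q') \<omega>s vs" and b: "b < q + q'"
    note parts = tensor_args_take_drop[OF args]
    show "linear_form_on V (\<lambda>v. f (take p \<omega>s) (take q (vs[b := v])) *
        g (drop p \<omega>s) (drop q (vs[b := v])))"
    proof (cases "b < q")
      case True
      then show ?thesis using f(2) parts(1)
        by (simp add: take_update_swap drop_update_cancel multilinear_form_def linear_form_on_cmult)
    next
      case False
      then show ?thesis using g(2) parts(2) b
        by (simp add: take_update_cancel drop_update_swap multilinear_form_def linear_form_on_cmult)
    qed
  next
    fix \<omega>s vs assume "\<not> tensor_args V (p + p') (q + q') \<omega>s vs"
    then show "f (take p \<omega>s) (take q vs) * g (drop p \<omega>s) (drop q vs) = 0"
      using tensor_args_append f(2) g(2) unfolding multilinear_form_def mult_eq_0_iff by blast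
  qed
  then show ?thesis unfolding f(1) g(1) tensor_prod_def tensors_iff by simp
qed

lemma contraction_tensors:
  assumes V: "subspace V" and cs: "coordinate_system V I \<alpha> a"
    and A: "A \<in> tensors V (Suc p) (Suc q)" and rs: "r \<le> p" "s \<le> q"
  shows "contraction V r s A \<in> tensors V p q"
proof -
  obtain f where f: "A = Tensor (Suc p) (Suc q) f" "multilinear_form V (Suc p) (Suc q) f"
    using A by (auto simp: tensors_def)
  have mem: "\<And>i. i \<in> I \<Longrightarrow> \<alpha> i \<in> dual_space V" "\<And>i. i \<in> I \<Longrightarrow> a i \<in> V"
    using cs by (auto simp: coordinate_system_def)
  have "multilinear_form V p q (\<lambda>\<omega>s vs. if tensor_args V p q \<omega>s vs
      then f (insert_at r (\<alpha> i) \<omega>s) (insert_at s (a i) vs) else 0)" (is "multilinear_form V p q ?f")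
    if i: "i \<in> I" for i
    unfolding multilinear_form_def
  proof (intro conjI allI impI)
    fix \<omega>s vs k assume args: "tensor_args V p q \<omega>s vs" and k: "k < p"
    have upd: "tensor_args V p q (\<omega>s[k := \<alpha>]) vs" if "\<alpha> \<in> dual_space V" for \<alpha>
      using args that set_update_subset_insert[of \<omega>s k \<alpha>] by (auto simp: tensor_args_def)
    have "linear_form_on (dual_space V)
      (\<lambda>\<alpha>'. f ((insert_at r (\<alpha> i) \<omega>s)[(if k < r then k else Suc k) := \<alpha>']) (insert_at s (a i) vs))"
      by (rule multilinear_form_covector[OF f(2) tensor_args_insert_at[OF args mem(1)[OF i] mem(2)[OF i]]])
        (use k in auto)
    moreover have "length \<omega>s = p" using args by (simp add: tensor_args_def)
    ultimately have "linear_form_on (dual_space V)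
      (\<lambda>\<alpha>'. f (insert_at r (\<alpha> i) (\<omega>s[k := \<alpha>'])) (insert_at s (a i) vs))"
      using rs k by (simp only: insert_at_of_update)
    then show "linear_form_on (dual_space V) (\<lambda>\<alpha>. ?f (\<omega>s[k := \<alpha>]) vs)"
      using upd subspace_dual_space[of V] by (simp add: linear_form_on_def subspace_def)
  next
    fix \<omega>s vs k assume args: "tensor_args V p q \<omega>s vs" and k: "k < q"
    have upd: "tensor_args V p q \<omega>s (vs[k := v])" if "v \<in> V" for v
      using args that set_update_subset_insert[of vs k v] by (auto simp: tensor_args_def)
    have "linear_form_on V
      (\<lambda>v. f (insert_at r (\<alpha> i) \<omega>s) ((insert_at s (a i) vs)[(if k < s then k else Suc k) := v]))"
      by (rule multilinear_form_vector[OF f(2) tensor_args_insert_at[OF args mem(1)[OF i] mem(2)[OF i]]])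
        (use k in auto)
    moreover have "length vs = q" using args by (simp add: tensor_args_def)
    ultimately have "linear_form_on V
      (\<lambda>v. f (insert_at r (\<alpha> i) \<omega>s) (insert_at s (a i) (vs[k := v])))"
      using rs k by (simp only: insert_at_of_update)
    then show "linear_form_on V (\<lambda>v. ?f \<omega>s (vs[k := v]))"
      using upd V by (simp add: linear_form_on_def subspace_def)
  qed simp
  note summands = this
  define F where "F i = (\<lambda>\<omega>s vs. if tensor_args V p q \<omega>s vs
      then f (insert_at r (\<alpha> i) \<omega>s) (insert_at s (a i) vs) else 0)" for i
  have "multilinear_form V p q (\<Sum>i\<in>I. 1 *\<^sub>R F i)"
    by (rule multilinear_form_sum[of I V p q F]) (unfold F_def, rule summands)
  moreover have "contraction V r s A = Tensor p q (\<Sum>i\<in>I. 1 *\<^sub>R F i)"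
    unfolding contraction_eq[OF V cs A rs] by (auto simp: F_def fun_eq_iff sum_fun_apply f(1))
  ultimately show ?thesis
    by (auto simp: tensors_def)
qed


section \<open>Components with respect to a pair of dual bases\<close>

locale frame =
  fixes V :: "'v::real_vector set" and e :: "'n::finite \<Rightarrow> 'v" and \<epsilon> :: "'n \<Rightarrow> 'v \<Rightarrow> real"
  assumes dual: "dual_bases V e \<epsilon>"
begin

lemma space_eq_span: "V = span (range e)"
  using dual by (simp add: dual_bases_def basis_of_def)

lemma subspace_space: "subspace V"
  by (simp add: space_eq_span)

lemma vector_in: "e i \<in> V"
  by (simp add: space_eq_span span_base)

lemma covector_in: "\<epsilon> i \<in> dual_space V"
proof -
  have "dual_space V = span (range \<epsilon>)"
    using dual by (simp add: dual_bases_def basis_of_def)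
  then show ?thesis by (simp add: span_base)
qed

lemma pairing [simp]: "\<epsilon> i (e j) = (if i = j then 1 else 0)"
  using dual by (simp add: dual_bases_def)

lemma covector_linear: "linear_form_on V (\<epsilon> i)"
  using covector_in by (simp add: dual_space_def)

lemma coeff_sum [simp]: "\<epsilon> j (\<Sum>i\<in>UNIV. c i *\<^sub>R e i) = c j"
  unfolding linear_form_on_sum[OF subspace_space covector_linear vector_in]
  by (simp add: if_distrib cong: if_cong)

lemma coeff_sum_covector [simp]: "(\<Sum>i\<in>UNIV. c i *\<^sub>R \<epsilon> i) (e j) = c j"
  by (simp add: sum_fun_apply if_distrib cong: if_cong)

lemma vector_expansion:
  assumes "v \<in> V" shows "(\<Sum>i\<in>UNIV. \<epsilon> i v *\<^sub>R e i) = v"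
proof -
  have "inj e" using dual by (simp add: dual_bases_def basis_of_def)
  obtain u where "v = (\<Sum>w\<in>range e. u w *\<^sub>R w)"
    using assms by (auto simp: space_eq_span span_finite)
  then have v: "v = (\<Sum>i\<in>UNIV. u (e i) *\<^sub>R e i)"
    by (simp add: sum.reindex[OF \<open>inj e\<close>])
  have "\<epsilon> j v = u (e j)" for j unfolding v by simp
  then show ?thesis using v by simp
qed

lemma coordinate_system: "coordinate_system V UNIV \<epsilon> e"
  by (simp add: coordinate_system_def covector_in vector_in vector_expansion)

lemma covector_expansion: "\<omega> \<in> dual_space V \<Longrightarrow> (\<Sum>i\<in>UNIV. \<omega> (e i) *\<^sub>R \<epsilon> i) = \<omega>"
  by (rule coordinate_system_covector[OF subspace_space coordinate_system])

lemma tensor_args_frame: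
  "length is = p \<Longrightarrow> length js = q \<Longrightarrow> tensor_args V p q (map \<epsilon> is) (map e js)"
  by (auto simp: tensor_args_def covector_in vector_in)

lemma tensor_expansion:
  assumes A: "A \<in> tensors V p q" and args: "tensor_args V p q \<omega>s vs"
  shows "form A \<omega>s vs = (\<Sum>is\<in>multi_indices p. \<Sum>js\<in>multi_indices q.
    (\<Prod>a<p. (\<omega>s ! a) (e (is ! a))) * (\<Prod>b<q. \<epsilon> (js ! b) (vs ! b)) * form A (map \<epsilon> is) (map e js))"
proof -
  have ml: "multilinear_form V p q (form A)" using A by (simp add: tensors_iff)
  have args': "length \<omega>s = p" "set \<omega>s \<subseteq> dual_space V" "length vs = q" "set vs \<subseteq> V"
    using args by (auto simp: tensor_args_def)
  have "form A \<omega>s vs = (\<Sum>is\<in>multi_indices p. (\<Prod>a<p. (\<omega>s ! a) (e (is ! a))) * form A (map \<epsilon> is) vs)"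
    using ml args'
    by (intro multilinear_expansion[where g = "\<lambda>\<omega>s. form A \<omega>s vs" and c = "\<lambda>i \<omega>. \<omega> (e i)"
          and U = "dual_space V"])
      (auto simp: subspace_dual_space covector_in covector_expansion multilinear_form_def tensor_args_def)
  also have "\<dots> = (\<Sum>is\<in>multi_indices p. (\<Prod>a<p. (\<omega>s ! a) (e (is ! a))) *
      (\<Sum>js\<in>multi_indices q. (\<Prod>b<q. \<epsilon> (js ! b) (vs ! b)) * form A (map \<epsilon> is) (map e js)))"
  proof (intro sum.cong refl arg_cong2[where f = "(*)"])
    fix "is" :: "'n list" assume "is \<in> multi_indices p"
    then have "tensor_args V p q (map \<epsilon> is) vs" if "set vs \<subseteq> V" "length vs = q" for vs
      using that by (auto simp: tensor_args_def multi_indices_def covector_in)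
    then show "form A (map \<epsilon> is) vs =
        (\<Sum>js\<in>multi_indices q. (\<Prod>b<q. \<epsilon> (js ! b) (vs ! b)) * form A (map \<epsilon> is) (map e js))"
      using ml args'
      by (intro multilinear_expansion[where U = V and c = \<epsilon>])
        (auto simp: subspace_space vector_in vector_expansion multilinear_form_def)
  qed
  finally show ?thesis by (simp add: sum_distrib_left mult.assoc)
qed

lemma basis_tensor_Nil: "basis_tensor V e \<epsilon> [] [] = scalar_tensor 1"
  by (simp add: basis_tensor_def)

lemma basis_tensor_vector:
  "basis_tensor V e \<epsilon> (i # is) js = vector_tensor V (e i) \<otimes>\<^sub>t basis_tensor V e \<epsilon> is js"
  by (simp add: basis_tensor_def)

lemma basis_tensor_covector:
  "basis_tensor V e \<epsilon> [] (j # js) = covector_tensor V (\<epsilon> j) \<otimes>\<^sub>t basis_tensor V e \<epsilon> [] js"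
  by (simp add: basis_tensor_def)

lemma basis_tensor_tensors: "basis_tensor V e \<epsilon> is js \<in> tensors V (length is) (length js)"
proof (induction "is")
  case Nil
  show ?case
  proof (induction js)
    case (Cons j js)
    then show ?case
      using tensor_prod_tensors[OF covector_tensor_tensors[OF subspace_space covector_in] Cons]
      by (simp add: basis_tensor_covector)
  qed (simp add: basis_tensor_Nil scalar_tensor_tensors)
next
  case (Cons i "is")
  then show ?case
    using tensor_prod_tensors[OF vector_tensor_tensors[OF vector_in] Cons]
    by (simp add: basis_tensor_vector)
qed

lemma form_basis_tensor:
  assumes "tensor_args V (length is) (length js) \<omega>s vs"
  shows "form (basis_tensor V e \<epsilon> is js) \<omega>s vs =
    (\<Prod>a<length is. (\<omega>s ! a) (e (is ! a))) * (\<Prod>b<length js. \<epsilon> (js ! b) (vs ! b))"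
  using assms
proof (induction "is" arbitrary: \<omega>s)
  case Nil
  then show ?case
  proof (induction js arbitrary: vs)
    case Nil
    then show ?case by (simp add: basis_tensor_Nil scalar_tensor_def tensor_args_def)
  next
    case (Cons j js)
    from Cons.prems obtain v vs' where vs: "vs = v # vs'" and
      args: "tensor_args V 0 1 [] [v]" "tensor_args V 0 (length js) [] vs'" and "\<omega>s = []"
      by (cases vs) (auto simp: tensor_args_def)
    then show ?case using Cons.IH[of vs'] unfolding basis_tensor_covector
      by (simp add: tensor_prod_def covector_tensor_def prod.lessThan_Suc_shift del: prod.lessThan_Suc)
  qed
next
  case (Cons i "is")
  from Cons.prems obtain \<omega> \<omega>s' where \<omega>s: "\<omega>s = \<omega> # \<omega>s'" and
    args: "tensor_args V 1 0 [\<omega>] []" "tensor_args V (length is) (length js) \<omega>s' vs"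
    by (cases \<omega>s) (auto simp: tensor_args_def)
  then show ?case using Cons.IH[of \<omega>s'] unfolding basis_tensor_vector
    by (simp add: tensor_prod_def vector_tensor_def prod.lessThan_Suc_shift del: prod.lessThan_Suc)
qed

lemma tensor_of_components_tensors: "tensor_of_components V e \<epsilon> p q T \<in> tensors V p q"
proof -
  have "(\<Sum>js\<in>multi_indices q. T is js *\<^sub>R form (basis_tensor V e \<epsilon> is js)) =
      form (Tensor p q (\<Sum>js\<in>multi_indices q. T is js *\<^sub>R form (basis_tensor V e \<epsilon> is js)))" for "is"
    by simp
  moreover have "Tensor p q (\<Sum>js\<in>multi_indices q. T is js *\<^sub>R form (basis_tensor V e \<epsilon> is js))
      \<in> tensors V p q" if "is \<in> multi_indices p" for "is"
    using that basis_tensor_tensors[of "is"] by (intro sum_tensors) (auto simp: multi_indices_def)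
  ultimately show ?thesis
    using sum_tensors[of "multi_indices p" "\<lambda>is. Tensor p q
      (\<Sum>js\<in>multi_indices q. T is js *\<^sub>R form (basis_tensor V e \<epsilon> is js))" V p q "\<lambda>_. 1"]
    by (simp add: tensor_of_components_def)
qed

lemma form_tensor_of_components:
  assumes "tensor_args V p q \<omega>s vs"
  shows "form (tensor_of_components V e \<epsilon> p q T) \<omega>s vs =
    (\<Sum>is\<in>multi_indices p. \<Sum>js\<in>multi_indices q.
      (\<Prod>a<p. (\<omega>s ! a) (e (is ! a))) * (\<Prod>b<q. \<epsilon> (js ! b) (vs ! b)) * T is js)"
  using assms unfolding tensor_of_components_def
  by (auto simp: sum_fun_apply multi_indices_def form_basis_tensor intro!: sum.cong)

lemma tensor_eq_components:
  assumes "A \<in> tensors V p q"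
  shows "A = tensor_of_components V e \<epsilon> p q (\<lambda>is js. form A (map \<epsilon> is) (map e js))"
  by (rule tensor_eqI[OF assms tensor_of_components_tensors])
    (simp add: form_tensor_of_components tensor_expansion[OF assms])

lemma tensor_eq_componentsI:
  assumes "A \<in> tensors V p q" "B \<in> tensors V p q"
    and "\<And>is js. is \<in> multi_indices p \<Longrightarrow> js \<in> multi_indices q \<Longrightarrow>
      form A (map \<epsilon> is) (map e js) = form B (map \<epsilon> is) (map e js)"
  shows "A = B"
  by (rule tensor_eqI[OF assms(1,2)])
    (simp add: tensor_expansion[OF assms(1)] tensor_expansion[OF assms(2)] assms(3))

lemma prod_pairing:
  assumes "length is = p" "length ks = p"
  shows "(\<Prod>a<p. \<epsilon> (ks ! a) (e (is ! a))) = (if is = ks then 1 else 0)"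
proof (cases "is = ks")
  case False
  then obtain a where "a < p" "ks ! a \<noteq> is ! a" using assms by (metis nth_equalityI)
  then have "(\<Prod>a<p. \<epsilon> (ks ! a) (e (is ! a))) = 0" by (intro prod_zero) auto
  then show ?thesis using False by simp
qed simp

lemma components_of_tensor_of_components:
  assumes "ks \<in> multi_indices p" "ls \<in> multi_indices q"
  shows "form (tensor_of_components V e \<epsilon> p q T) (map \<epsilon> ks) (map e ls) = T ks ls"
proof -
  have len: "length ks = p" "length ls = q" using assms by (auto simp: multi_indices_def)
  have "form (tensor_of_components V e \<epsilon> p q T) (map \<epsilon> ks) (map e ls) =
    (\<Sum>is\<in>multi_indices p. \<Sum>js\<in>multi_indices q.
      (if is = ks then 1 else 0) * (if js = ls then 1 else 0) * T is js)"
    unfolding form_tensor_of_components[OF tensor_args_frame[OF len]]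
  proof (intro sum.cong refl)
    fix "is" js :: "'n list" assume "is \<in> multi_indices p" "js \<in> multi_indices q"
    then have "length is = p" "length js = q" by (auto simp: multi_indices_def)
    then show "(\<Prod>a<p. (map \<epsilon> ks ! a) (e (is ! a))) * (\<Prod>b<q. \<epsilon> (js ! b) (map e ls ! b)) * T is js =
        (if is = ks then 1 else 0) * (if js = ls then 1 else 0) * T is js"
      using len prod_pairing[of "is" p ks] prod_pairing[of ls q js] by auto
  qed
  also have "\<dots> = (\<Sum>is\<in>multi_indices p. if is = ks then
      (\<Sum>js\<in>multi_indices q. if js = ls then T is js else 0) else 0)"
    by (intro sum.cong refl) (simp add: if_distrib[of "\<lambda>c. c * _"] cong: if_cong)
  also have "\<dots> = T ks ls" using assms by simp
  finally show ?thesis .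
qed

lemma form_vector_tensor [simp]: "form (vector_tensor V v) [\<epsilon> i] [] = \<epsilon> i v"
  by (simp add: vector_tensor_def tensor_args_def covector_in)

lemma form_covector_tensor [simp]: "form (covector_tensor V \<omega>) [] [e i] = \<omega> (e i)"
  by (simp add: covector_tensor_def tensor_args_def vector_in)

lemma vector_tensor_expansion:
  assumes A: "A \<in> tensors V 1 0"
  shows "A = Tensor 1 0 (\<Sum>k\<in>UNIV. form A [\<epsilon> k] [] *\<^sub>R form (vector_tensor V (e k)))"
proof (rule tensor_eq_componentsI[OF A sum_tensors[OF vector_tensor_tensors[OF vector_in]]])
  fix "is" js :: "'n list" assume "is \<in> multi_indices 1" "js \<in> multi_indices 0"
  then obtain i where "is = [i]" "js = []" by (auto simp: multi_indices_def length_Suc_conv)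
  then show "form A (map \<epsilon> is) (map e js) =
      form (Tensor 1 0 (\<Sum>k\<in>UNIV. form A [\<epsilon> k] [] *\<^sub>R form (vector_tensor V (e k)))) (map \<epsilon> is) (map e js)"
    by (simp add: sum_fun_apply if_distrib cong: if_cong)
qed

text \<open>Contracting a vector with a covector evaluates their pairing, which is how the relation between
  the matrices for upper and for lower indices enters.\<close>

lemma contraction_tensor_prod:
  assumes A: "A \<in> tensors V 1 0" and B: "B \<in> tensors V 0 1"
  shows "contraction V 0 0 (A \<otimes>\<^sub>t B) = scalar_tensor (\<Sum>k\<in>UNIV. form A [\<epsilon> k] [] * form B [] [e k])"
proof -
  have "A \<otimes>\<^sub>t B \<in> tensors V (Suc 0) (Suc 0)"
    using tensor_prod_tensors[OF A B] by simp
  then have "contraction V 0 0 (A \<otimes>\<^sub>t B) = Tensor 0 0 (\<lambda>\<omega>s vs. if tensor_args V 0 0 \<omega>s vs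
    then \<Sum>i\<in>UNIV. form (A \<otimes>\<^sub>t B) (insert_at 0 (\<epsilon> i) \<omega>s) (insert_at 0 (e i) vs) else 0)"
    by (rule contraction_eq[OF subspace_space coordinate_system]) auto
  then show ?thesis using A B
    by (auto simp: scalar_tensor_def tensor_args_def insert_at_def tensor_prod_def tensors_iff fun_eq_iff)
qed

end


section \<open>Pulling tensors back\<close>

text \<open>Let \<open>e\<close>, \<open>\<epsilon>\<close> be dual bases of \<open>V\<close> and \<open>d\<close>, \<open>\<delta>\<close> dual bases of \<open>W\<close>. The matrix \<open>H\<close> describes the
  linear map \<open>e i \<mapsto> (\<Sum>k. H k i *\<^sub>R d k)\<close> from \<open>V\<close> to \<open>W\<close>, and \<open>pull_covector\<close> is its transpose.
  The matrix \<open>H'\<close> of a map of covectors gives in the same way the map \<open>pull_vector\<close> from \<open>W\<close> to \<open>V\<close>;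
  when \<open>H'\<close> is contragredient to \<open>H\<close>, this is the inverse of the map described by \<open>H\<close>.\<close>

definition pull_covector ::
    "('n \<Rightarrow> 'n \<Rightarrow> real) \<Rightarrow> ('n \<Rightarrow> 'w) \<Rightarrow> ('n::finite \<Rightarrow> 'v \<Rightarrow> real) \<Rightarrow> ('w \<Rightarrow> real) \<Rightarrow> 'v \<Rightarrow> real"
  where "pull_covector H d \<epsilon> \<omega> = (\<Sum>i\<in>UNIV. (\<Sum>k\<in>UNIV. H k i * \<omega> (d k)) *\<^sub>R \<epsilon> i)"

definition pull_vector ::
    "('n \<Rightarrow> 'n \<Rightarrow> real) \<Rightarrow> ('n \<Rightarrow> 'w \<Rightarrow> real) \<Rightarrow> ('n::finite \<Rightarrow> 'v::real_vector) \<Rightarrow> 'w \<Rightarrow> 'v"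
  where "pull_vector H' \<delta> e w = (\<Sum>j\<in>UNIV. (\<Sum>l\<in>UNIV. H' l j * \<delta> l w) *\<^sub>R e j)"

text \<open>A tensor is transported by letting it act on arguments that have been moved back. This form of
  the transport refers to no components, so that compatibility with linear combinations, products and
  compositions can be read off. It is a relation rather than a function because the transport to be
  studied is given in advance.\<close>

definition is_pullback ::
    "'v::real_vector set \<Rightarrow> (('v \<Rightarrow> real) \<Rightarrow> 'v \<Rightarrow> real) \<Rightarrow> ('v \<Rightarrow> 'v) \<Rightarrow> 'v tensor \<Rightarrow> 'v tensor \<Rightarrow> bool"
  where "is_pullback W P Q A B \<longleftrightarrow> B \<in> tensors W (contra_rank A) (co_rank A) \<and>
    (\<forall>\<omega>s vs. tensor_args W (contra_rank A) (co_rank A) \<omega>s vs \<longrightarrow>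
      form B \<omega>s vs = form A (map P \<omega>s) (map Q vs))"

lemma is_pullback_form:
  "is_pullback W P Q A B \<Longrightarrow> A \<in> tensors V p q \<Longrightarrow> tensor_args W p q \<omega>s vs \<Longrightarrow>
    form B \<omega>s vs = form A (map P \<omega>s) (map Q vs)"
  by (simp add: is_pullback_def tensors_iff)

lemma is_pullback_tensors:
  "is_pullback W P Q A B \<Longrightarrow> A \<in> tensors V p q \<Longrightarrow> B \<in> tensors W p q"
  by (simp add: is_pullback_def tensors_iff)

lemma is_pullback_unique: "is_pullback W P Q A B \<Longrightarrow> is_pullback W P Q A B' \<Longrightarrow> B = B'"
  unfolding is_pullback_def by (auto intro!: tensor_eqI)

lemma is_pullback_lincomb:
  assumes "is_pullback W P Q A B" "is_pullback W P Q A' B'"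
    and "A \<in> tensors V p q" "A' \<in> tensors V p q"
  shows "is_pullback W P Q (lincomb l A m A') (lincomb l B m B')"
  unfolding is_pullback_def
  using lincomb_tensors[OF assms(1)[THEN is_pullback_tensors, OF assms(3)]
      assms(2)[THEN is_pullback_tensors, OF assms(4)]] assms
  by (simp add: is_pullback_def lincomb_def tensors_iff)

lemma is_pullback_tensor_prod:
  assumes "is_pullback W P Q A B" "is_pullback W P Q A' B'"
  shows "is_pullback W P Q (A \<otimes>\<^sub>t A') (B \<otimes>\<^sub>t B')"
proof -
  have ranks: "contra_rank B = contra_rank A" "co_rank B = co_rank A"
    using assms(1) by (auto simp: is_pullback_def tensors_iff)
  have "B \<otimes>\<^sub>t B' \<in> tensors W (contra_rank (A \<otimes>\<^sub>t A')) (co_rank (A \<otimes>\<^sub>t A'))"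
    using tensor_prod_tensors[of B W _ _ B'] assms by (simp add: is_pullback_def tensor_prod_def[of A])
  moreover have "form (B \<otimes>\<^sub>t B') \<omega>s vs = form (A \<otimes>\<^sub>t A') (map P \<omega>s) (map Q vs)"
    if "tensor_args W (contra_rank (A \<otimes>\<^sub>t A')) (co_rank (A \<otimes>\<^sub>t A')) \<omega>s vs" for \<omega>s vs
    using tensor_args_take_drop[of W "contra_rank A" "contra_rank A'" "co_rank A" "co_rank A'" \<omega>s vs]
      that assms
    by (simp add: is_pullback_def tensor_prod_def ranks take_map drop_map)
  ultimately show ?thesis by (simp add: is_pullback_def)
qed

lemma is_pullback_compose:
  assumes AB: "is_pullback W P Q A B" and BC: "is_pullback U P' Q' B C"
    and P': "\<And>\<omega>. \<omega> \<in> dual_space U \<Longrightarrow> P' \<omega> \<in> dual_space W" and Q': "\<And>v. v \<in> U \<Longrightarrow> Q' v \<in> W"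
  shows "is_pullback U (P \<circ> P') (Q \<circ> Q') A C"
proof -
  have ranks: "contra_rank B = contra_rank A" "co_rank B = co_rank A"
    using AB by (auto simp: is_pullback_def tensors_iff)
  have "tensor_args W p q (map P' \<omega>s) (map Q' vs)" if "tensor_args U p q \<omega>s vs" for p q \<omega>s vs
    using that P' Q' by (auto simp: tensor_args_def)
  then show ?thesis using AB BC by (simp add: is_pullback_def ranks)
qed

text \<open>Here the frame belongs to the intermediate space. Moving back in two steps multiplies the
  matrices, and the order of the factors is the same for upper and for lower indices.\<close>

lemma (in frame) pull_covector_compose:
  assumes "\<And>i j. (\<Sum>k\<in>UNIV. H2 i k * H1 k j) = H3 i j"
  shows "pull_covector H1 e \<epsilon>' (pull_covector H2 c \<epsilon> \<omega>) = pull_covector H3 c \<epsilon>' \<omega>"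
proof -
  have "(\<Sum>k\<in>UNIV. H1 k i * (\<Sum>m\<in>UNIV. H2 m k * \<omega> (c m))) = (\<Sum>m\<in>UNIV. H3 m i * \<omega> (c m))" for i
    unfolding assms[symmetric] sum_distrib_left sum_distrib_right
    by (subst sum.swap) (simp add: mult_ac)
  then show ?thesis by (simp add: pull_covector_def)
qed

lemma (in frame) pull_vector_compose:
  assumes "\<And>i j. (\<Sum>k\<in>UNIV. H2 i k * H1 k j) = H3 i j"
  shows "pull_vector H1 \<epsilon> e' (pull_vector H2 \<gamma> e w) = pull_vector H3 \<gamma> e' w"
proof -
  have "(\<Sum>k\<in>UNIV. H1 k i * (\<Sum>m\<in>UNIV. H2 m k * \<gamma> m w)) = (\<Sum>m\<in>UNIV. H3 m i * \<gamma> m w)" for i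
    unfolding assms[symmetric] sum_distrib_left sum_distrib_right
    by (subst sum.swap) (simp add: mult_ac)
  then show ?thesis by (simp add: pull_vector_def)
qed

lemma (in frame) is_pullback_identity:
  assumes "\<And>i j. H i j = (if i = j then 1 else 0)" "\<And>i j. H' i j = (if i = j then 1 else 0)"
    and A: "A \<in> tensors V p q"
  shows "is_pullback V (pull_covector H e \<epsilon>) (pull_vector H' \<epsilon> e) A A"
proof -
  have "pull_covector H e \<epsilon> \<omega> = \<omega>" if "\<omega> \<in> dual_space V" for \<omega>
    using covector_expansion[OF that] by (simp add: pull_covector_def assms(1) if_distrib[of "\<lambda>c. c * _"] cong: if_cong)
  moreover have "pull_vector H' \<epsilon> e v = v" if "v \<in> V" for v
    using vector_expansion[OF that] by (simp add: pull_vector_def assms(2) if_distrib[of "\<lambda>c. c * _"] cong: if_cong)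
  ultimately have "map (pull_covector H e \<epsilon>) \<omega>s = \<omega>s" "map (pull_vector H' \<epsilon> e) vs = vs"
    if "tensor_args V p q \<omega>s vs" for \<omega>s vs
    using that by (auto simp: tensor_args_def intro!: map_idI)
  then show ?thesis using A by (simp add: is_pullback_def tensors_iff)
qed

text \<open>Contragredient matrices are those that preserve the pairing of vectors with covectors, and hence
  contractions.\<close>

locale frame_change = src: frame V e \<epsilon> + tgt: frame W d \<delta>
  for V :: "'v::real_vector set" and e :: "'n::finite \<Rightarrow> 'v" and \<epsilon>
    and W :: "'v set" and d :: "'n \<Rightarrow> 'v" and \<delta> +
  fixes H H' :: "'n \<Rightarrow> 'n \<Rightarrow> real"
  assumes inverse: "\<And>i j. (\<Sum>k\<in>UNIV. H k i * H' k j) = (if i = j then 1 else 0)"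
begin

abbreviation P where "P \<equiv> pull_covector H d \<epsilon>"
abbreviation Q where "Q \<equiv> pull_vector H' \<delta> e"

lemma pull_covector_in: "P \<omega> \<in> dual_space V"
  unfolding pull_covector_def
  by (intro subspace_sum[OF subspace_dual_space] subspace_scale[OF subspace_dual_space] src.covector_in)

lemma pull_vector_in: "Q w \<in> V"
  unfolding pull_vector_def
  by (intro subspace_sum[OF src.subspace_space] subspace_scale[OF src.subspace_space] src.vector_in)

text \<open>Since \<open>H\<close> and \<open>H'\<close> are contragredient, dual bases of \<open>W\<close> are moved back to a resolution of the
  identity of \<open>V\<close>.\<close>

lemma coordinate_system_pulled: "coordinate_system V UNIV (\<lambda>k. P (\<delta> k)) (\<lambda>k. Q (d k))"
proof -
  have P: "P (\<delta> k) v = (\<Sum>i\<in>UNIV. H k i * \<epsilon> i v)" for k v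
    by (simp add: pull_covector_def sum_fun_apply if_distrib cong: if_cong)
  have Q: "Q (d k) = (\<Sum>j\<in>UNIV. H' k j *\<^sub>R e j)" for k
    by (simp add: pull_vector_def if_distrib cong: if_cong)
  have "(\<Sum>k\<in>UNIV. P (\<delta> k) v *\<^sub>R Q (d k)) = v" if "v \<in> V" for v
  proof -
    have "(\<Sum>k\<in>UNIV. P (\<delta> k) v *\<^sub>R Q (d k)) =
        (\<Sum>k\<in>UNIV. \<Sum>j\<in>UNIV. \<Sum>i\<in>UNIV. (H k i * H' k j * \<epsilon> i v) *\<^sub>R e j)"
      unfolding P Q scaleR_sum_right scaleR_scaleR
      by (simp add: sum_distrib_left sum_distrib_right scaleR_sum_left mult_ac)
    also have "\<dots> = (\<Sum>j\<in>UNIV. \<Sum>k\<in>UNIV. \<Sum>i\<in>UNIV. (H k i * H' k j * \<epsilon> i v) *\<^sub>R e j)"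
      by (rule sum.swap)
    also have "\<dots> = (\<Sum>j\<in>UNIV. (\<Sum>i\<in>UNIV. (\<Sum>k\<in>UNIV. H k i * H' k j) * \<epsilon> i v) *\<^sub>R e j)"
    proof (rule sum.cong[OF refl])
      fix j
      show "(\<Sum>k\<in>UNIV. \<Sum>i\<in>UNIV. (H k i * H' k j * \<epsilon> i v) *\<^sub>R e j) =
          (\<Sum>i\<in>UNIV. (\<Sum>k\<in>UNIV. H k i * H' k j) * \<epsilon> i v) *\<^sub>R e j"
        by (subst sum.swap) (simp add: scaleR_sum_left sum_distrib_right)
    qed
    also have "\<dots> = (\<Sum>j\<in>UNIV. \<epsilon> j v *\<^sub>R e j)"
      by (simp add: inverse if_distrib[of "\<lambda>c. c * _"] cong: if_cong)
    finally show ?thesis using src.vector_expansion[OF that] by simp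
  qed
  then show ?thesis by (simp add: coordinate_system_def pull_covector_in pull_vector_in)
qed

text \<open>The contraction over \<open>W\<close> is computed in the frame of \<open>W\<close>, the one over \<open>V\<close> in that frame moved
  back to \<open>V\<close>; by the independence of coordinates this is legitimate, and then both are the same sum.\<close>

lemma is_pullback_contraction:
  assumes pb: "is_pullback W P Q A B"
    and A: "A \<in> tensors V (Suc p) (Suc q)" and rs: "r \<le> p" "s \<le> q"
  shows "is_pullback W P Q (contraction V r s A) (contraction W r s B)"
proof -
  note B = is_pullback_tensors[OF pb A]
  note CA = contraction_eq[OF src.subspace_space coordinate_system_pulled A rs]
  note CB = contraction_eq[OF tgt.subspace_space tgt.coordinate_system B rs]
  have "form (contraction W r s B) \<omega>s vs = form (contraction V r s A) (map P \<omega>s) (map Q vs)"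
    if args: "tensor_args W p q \<omega>s vs" for \<omega>s vs
  proof -
    have "tensor_args V p q (map P \<omega>s) (map Q vs)"
      using args by (auto simp: tensor_args_def pull_covector_in pull_vector_in)
    moreover have "form B (insert_at r (\<delta> k) \<omega>s) (insert_at s (d k) vs) =
        form A (insert_at r (P (\<delta> k)) (map P \<omega>s)) (insert_at s (Q (d k)) (map Q vs))" for k
      using is_pullback_form[OF pb A tensor_args_insert_at[OF args tgt.covector_in tgt.vector_in]]
      by (simp add: map_insert_at)
    ultimately show ?thesis using args by (simp add: CA CB)
  qed
  moreover have "contraction W r s B \<in> tensors W p q"
    by (rule contraction_tensors[OF tgt.subspace_space tgt.coordinate_system B rs])
  ultimately show ?thesis by (simp add: is_pullback_def CA)
qed

text \<open>Evaluating a tensor on arguments that were moved back produces products of sums over single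
  indices. Distributing them gives the sums over multi-indices with products of matrix entries.\<close>

lemma is_pullback_components:
  "is_pullback W P Q (tensor_of_components V e \<epsilon> p q T)
    (tensor_of_components W d \<delta> p q (\<lambda>ks ls. \<Sum>is\<in>multi_indices p. \<Sum>js\<in>multi_indices q.
      (\<Prod>a<p. H (ks ! a) (is ! a)) * (\<Prod>b<q. H' (ls ! b) (js ! b)) * T is js))"
    (is "is_pullback W P Q ?A ?B")
proof -
  have "form ?B \<omega>s vs = form ?A (map P \<omega>s) (map Q vs)"
    if args: "tensor_args W p q \<omega>s vs" for \<omega>s vs
  proof -
    have len: "length \<omega>s = p" "length vs = q" using args by (auto simp: tensor_args_def)
    have args': "tensor_args V p q (map P \<omega>s) (map Q vs)"
      using args by (auto simp: tensor_args_def pull_covector_in pull_vector_in)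
    have P: "(\<Prod>a<p. (map P \<omega>s ! a) (e (is ! a))) =
        (\<Sum>ks\<in>multi_indices p. (\<Prod>a<p. H (ks ! a) (is ! a)) * (\<Prod>a<p. (\<omega>s ! a) (d (ks ! a))))" for "is"
      by (simp add: len pull_covector_def prod_sum_multi_indices prod.distrib)
    have Q: "(\<Prod>b<q. \<epsilon> (js ! b) (map Q vs ! b)) =
        (\<Sum>ls\<in>multi_indices q. (\<Prod>b<q. H' (ls ! b) (js ! b)) * (\<Prod>b<q. \<delta> (ls ! b) (vs ! b)))" for js
      by (simp add: len pull_vector_def prod_sum_multi_indices prod.distrib)
    let ?t = "\<lambda>is js ks ls. ((\<Prod>a<p. H (ks ! a) (is ! a)) * (\<Prod>a<p. (\<omega>s ! a) (d (ks ! a)))) *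
      ((\<Prod>b<q. H' (ls ! b) (js ! b)) * (\<Prod>b<q. \<delta> (ls ! b) (vs ! b))) * T is js"
    let ?I = "multi_indices p \<times> multi_indices q :: ('n list \<times> 'n list) set"
    have "form ?A (map P \<omega>s) (map Q vs) = (\<Sum>(is, js)\<in>?I. \<Sum>(ks, ls)\<in>?I. ?t is js ks ls)"
      unfolding src.form_tensor_of_components[OF args'] P Q sum_product
      by (simp only: sum_distrib_right sum.cartesian_product[symmetric])
    also have "\<dots> = (\<Sum>(ks, ls)\<in>?I. \<Sum>(is, js)\<in>?I. ?t is js ks ls)"
      unfolding case_prod_unfold by (rule sum.swap)
    also have "\<dots> = form ?B \<omega>s vs"
      unfolding tgt.form_tensor_of_components[OF args]
      by (simp add: sum_distrib_left sum.cartesian_product[symmetric] mult_ac)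
    finally show ?thesis by simp
  qed
  moreover have "?B \<in> tensors W p q" by (rule tgt.tensor_of_components_tensors)
  ultimately show ?thesis by (simp add: is_pullback_def tensor_of_components_def)
qed

end


section \<open>Matrix cocycles\<close>

lemma matrix_inv_cancel:
  fixes A :: "real ^ 'n ^ 'n"
  assumes "invertible A"
  shows "A ** matrix_inv A = mat 1" "matrix_inv A ** A = mat 1"
proof -
  have "A ** matrix_inv A = mat 1 \<and> matrix_inv A ** A = mat 1"
    using assms unfolding invertible_def matrix_inv_def by (rule someI_ex)
  then show "A ** matrix_inv A = mat 1" "matrix_inv A ** A = mat 1" by simp_all
qed

text \<open>In the products \<open>F\<^sub>z\<^sup>-\<^sup>1 F\<^sub>y F\<^sub>y\<^sup>-\<^sup>1 F\<^sub>x\<close> the inner factors cancel, so the matrices \<open>H\<close> form a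
  cocycle. The matrices \<open>H'\<close> are their inverse transposes and inherit this. The first conclusion is
  the hypothesis \<open>dual\<close> with row and column indices exchanged, a right inverse of a square matrix being
  a left inverse.\<close>

lemma matrix_cocycle:
  fixes F :: "'a \<Rightarrow> real ^ 'n ^ 'n" and H H' :: "'n::finite \<Rightarrow> 'n \<Rightarrow> 'a \<Rightarrow> 'a \<Rightarrow> real"
  assumes inv: "\<And>x. x \<in> M \<Longrightarrow> invertible (F x)"
    and HF: "\<And>x y. x \<in> M \<Longrightarrow> y \<in> M \<Longrightarrow> (\<chi> i j. H i j y x) = matrix_inv (F y) ** F x"
    and dual: "\<And>x y i j. x \<in> M \<Longrightarrow> y \<in> M \<Longrightarrow>
      (\<Sum>k\<in>UNIV. H i k y x * H' j k y x) = (if i = j then 1 else 0)"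
  shows "x \<in> M \<Longrightarrow> y \<in> M \<Longrightarrow> (\<Sum>k\<in>UNIV. H k i y x * H' k j y x) = (if i = j then 1 else 0)"
    and "x \<in> M \<Longrightarrow> y \<in> M \<Longrightarrow> z \<in> M \<Longrightarrow> (\<Sum>k\<in>UNIV. H i k z y * H k j y x) = H i j z x"
    and "x \<in> M \<Longrightarrow> y \<in> M \<Longrightarrow> z \<in> M \<Longrightarrow> (\<Sum>k\<in>UNIV. H' i k z y * H' k j y x) = H' i j z x"
    and "x \<in> M \<Longrightarrow> H i j x x = (if i = j then 1 else 0)"
    and "x \<in> M \<Longrightarrow> H' i j x x = (if i = j then 1 else 0)"
proof -
  define A where "A y x = (\<chi> i j. H i j y x)" for y x
  \<comment> \<open>The transpose makes \<open>B y x\<close> the inverse of \<open>A y x\<close>.\<close>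
  define B where "B y x = (\<chi> i j. H' j i y x)" for y x
  have AB: "A y x ** B y x = mat 1" if "x \<in> M" "y \<in> M" for x y
    using dual[OF that] by (simp add: A_def B_def matrix_matrix_mult_def mat_def vec_eq_iff)
  then have BA: "B y x ** A y x = mat 1" if "x \<in> M" "y \<in> M" for x y
    using that by (simp add: matrix_left_right_inverse)
  have F: "F x ** matrix_inv (F x) = mat 1" "matrix_inv (F x) ** F x = mat 1" if "x \<in> M" for x
    by (rule matrix_inv_cancel[OF inv[OF that]])+
  have A: "A y x = matrix_inv (F y) ** F x" if "x \<in> M" "y \<in> M" for x y
    using HF[OF that] by (simp add: A_def)
  have AA: "A z y ** A y x = A z x" if "x \<in> M" "y \<in> M" "z \<in> M" for x y z
  proof -
    have "A z y ** A y x = matrix_inv (F z) ** (F y ** matrix_inv (F y)) ** F x"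
      using that by (simp add: A matrix_mul_assoc)
    then show ?thesis using that by (simp add: A F)
  qed
  have BB: "B y x ** B z y = B z x" if "x \<in> M" "y \<in> M" "z \<in> M" for x y z
  proof -
    have "A z x ** (B y x ** B z y) = A z y ** (A y x ** B y x) ** B z y"
      using that by (simp add: AA[symmetric, of x y z] matrix_mul_assoc)
    also have "\<dots> = mat 1" using that by (simp add: AB)
    finally have "B z x ** (A z x ** (B y x ** B z y)) = B z x" by simp
    then show ?thesis using that by (simp add: matrix_mul_assoc BA)
  qed
  have A1: "A x x = mat 1" if "x \<in> M" for x
    using that by (simp add: A F)
  have B1: "B x x = mat 1" if "x \<in> M" for x
    using AB[OF that that] A1[OF that] by simp
  show "(\<Sum>k\<in>UNIV. H k i y x * H' k j y x) = (if i = j then 1 else 0)" if "x \<in> M" "y \<in> M"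
  proof -
    have "(B y x ** A y x) $ j $ i = (mat 1 :: real ^ 'n ^ 'n) $ j $ i" using BA[OF that] by simp
    then show ?thesis
      by (auto simp: A_def B_def matrix_matrix_mult_def mat_def mult.commute)
  qed
  show "(\<Sum>k\<in>UNIV. H i k z y * H k j y x) = H i j z x" if "x \<in> M" "y \<in> M" "z \<in> M"
    using arg_cong[OF AA[OF that], of "\<lambda>X. X $ i $ j"] by (simp add: A_def matrix_matrix_mult_def)
  show "(\<Sum>k\<in>UNIV. H' i k z y * H' k j y x) = H' i j z x" if "x \<in> M" "y \<in> M" "z \<in> M"
    using arg_cong[OF BB[OF that], of "\<lambda>X. X $ j $ i"]
    by (simp add: B_def matrix_matrix_mult_def mult.commute)
  show "H i j x x = (if i = j then 1 else 0)" if "x \<in> M"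
    using arg_cong[OF A1[OF that], of "\<lambda>X. X $ i $ j"] by (simp add: A_def mat_def)
  show "H' i j x x = (if i = j then 1 else 0)" if "x \<in> M"
    using arg_cong[OF B1[OF that], of "\<lambda>X. X $ j $ i"] by (auto simp: B_def mat_def)
qed

text \<open>Every point is compared with one base point: \<open>F x\<close> is the matrix from \<open>x\<close> to \<open>x\<^sub>0\<close>, whose inverse is
  the matrix from \<open>x\<^sub>0\<close> to \<open>x\<close>.\<close>

lemma cocycle_factorization:
  fixes H :: "'n::finite \<Rightarrow> 'n \<Rightarrow> 'a \<Rightarrow> 'a \<Rightarrow> real"
  assumes cocycle: "\<And>x y z i j. x \<in> M \<Longrightarrow> y \<in> M \<Longrightarrow> z \<in> M \<Longrightarrow>
      (\<Sum>k\<in>UNIV. H i k z y * H k j y x) = H i j z x"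
    and id: "\<And>x i j. x \<in> M \<Longrightarrow> H i j x x = (if i = j then 1 else 0)"
  shows "\<exists>F :: 'a \<Rightarrow> real ^ 'n ^ 'n. (\<forall>x\<in>M. invertible (F x)) \<and>
    (\<forall>x\<in>M. \<forall>y\<in>M. (\<chi> i j. H i j y x) = matrix_inv (F y) ** F x)"
proof (cases "M = {}")
  case False
  then obtain x\<^sub>0 where x\<^sub>0: "x\<^sub>0 \<in> M" by blast
  define A :: "'a \<Rightarrow> 'a \<Rightarrow> real ^ 'n ^ 'n" where "A y x = (\<chi> i j. H i j y x)" for y x
  have AA: "A z y ** A y x = A z x" if "x \<in> M" "y \<in> M" "z \<in> M" for x y z
    using cocycle[OF that] by (simp add: A_def matrix_matrix_mult_def vec_eq_iff)
  have A1: "A x x = mat 1" if "x \<in> M" for x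
    using id[OF that] by (simp add: A_def mat_def vec_eq_iff)
  have inv: "invertible (A x\<^sub>0 x)" "matrix_inv (A x\<^sub>0 x) = A x x\<^sub>0" if "x \<in> M" for x
  proof -
    have "A x\<^sub>0 x ** A x x\<^sub>0 = mat 1" "A x x\<^sub>0 ** A x\<^sub>0 x = mat 1" using AA A1 x\<^sub>0 that by auto
    then show *: "invertible (A x\<^sub>0 x)" by (auto simp: invertible_def)
    have "matrix_inv (A x\<^sub>0 x) = matrix_inv (A x\<^sub>0 x) ** (A x\<^sub>0 x ** A x x\<^sub>0)"
      using \<open>A x\<^sub>0 x ** A x x\<^sub>0 = mat 1\<close> by simp
    then show "matrix_inv (A x\<^sub>0 x) = A x x\<^sub>0"
      by (simp add: matrix_mul_assoc matrix_inv_cancel(2)[OF *])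
  qed
  then show ?thesis
    using AA x\<^sub>0 by (intro exI[of _ "A x\<^sub>0"]) (simp add: A_def[symmetric])
qed simp


section \<open>Flat linear transports in frames\<close>

text \<open>For the empty sum the zero tensor is seen as a linear combination of itself with coefficients
  \<open>0\<close>, because a \<open>lincomb\<close> needs two tensors of the right type.\<close>

lemma linear_on_tensor_sum:
  fixes f :: "'v::real_vector tensor \<Rightarrow> 'v tensor" and c :: "'i \<Rightarrow> real" and A :: "'i \<Rightarrow> 'v tensor"
  assumes types: "\<And>A. A \<in> tensors V p q \<Longrightarrow> f A \<in> tensors W p q"
    and linear: "\<And>A A' l m. A \<in> tensors V p q \<Longrightarrow> A' \<in> tensors V p q \<Longrightarrow>
      f (lincomb l A m A') = lincomb l (f A) m (f A')"
    and "finite I" "\<And>i. i \<in> I \<Longrightarrow> A i \<in> tensors V p q"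
  shows "f (Tensor p q (\<Sum>i\<in>I. c i *\<^sub>R form (A i))) = Tensor p q (\<Sum>i\<in>I. c i *\<^sub>R form (f (A i)))"
  using assms(3,4)
proof (induction I)
  case empty
  let ?Z = "Tensor p q 0 :: 'v tensor"
  have Z: "?Z \<in> tensors V p q"
    using sum_tensors[of "{}" A V p q] by simp
  have "f ?Z = f (lincomb 0 ?Z 0 ?Z)" by (simp add: lincomb_def)
  also have "\<dots> = lincomb 0 (f ?Z) 0 (f ?Z)" by (rule linear[OF Z Z])
  also have "\<dots> = ?Z" using types[OF Z] by (simp add: lincomb_def tensors_iff)
  finally have "f (Tensor p q (\<Sum>i\<in>{}. c i *\<^sub>R form (A i))) = Tensor p q (\<Sum>i\<in>{}. c i *\<^sub>R form (f (A i)))"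
    by simp
  then show ?case .
next
  case (insert i I)
  let ?S = "Tensor p q (\<Sum>i\<in>I. c i *\<^sub>R form (A i))"
  have S: "?S \<in> tensors V p q" using insert.prems by (intro sum_tensors) simp
  have Ai: "A i \<in> tensors V p q" using insert.prems by simp
  have "Tensor p q (\<Sum>i\<in>insert i I. c i *\<^sub>R form (A i)) = lincomb (c i) (A i) 1 ?S"
    using insert.hyps Ai by (simp add: lincomb_def tensors_iff)
  then have "f (Tensor p q (\<Sum>i\<in>insert i I. c i *\<^sub>R form (A i))) = lincomb (c i) (f (A i)) 1 (f ?S)"
    using linear[OF Ai S] by simp
  also have "f ?S = Tensor p q (\<Sum>i\<in>I. c i *\<^sub>R form (f (A i)))"
    by (rule insert.IH) (simp add: insert.prems)
  also have "lincomb (c i) (f (A i)) 1 \<dots> = Tensor p q (\<Sum>i\<in>insert i I. c i *\<^sub>R form (f (A i)))"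
    using insert.hyps types[OF Ai] by (simp add: lincomb_def tensors_iff)
  finally show ?case .
qed

locale framed_manifold =
  fixes X :: "'a topology" and \<A> :: "('a, 'n::finite) chart set"
    and E :: "'a \<Rightarrow> 'n \<Rightarrow> ('a, 'n) tangent_vector"
    and E' :: "'a \<Rightarrow> 'n \<Rightarrow> ('a, 'n) tangent_vector \<Rightarrow> real"
    and L :: "('a, 'n) transport_map"
  assumes bases: "\<And>x. x \<in> topspace X \<Longrightarrow> dual_bases (tangent_space \<A> x) (E x) (E' x)"
begin

abbreviation M where "M \<equiv> topspace X"
abbreviation T where "T x \<equiv> tangent_space \<A> x"

lemma frame_at: "x \<in> M \<Longrightarrow> frame (T x) (E x) (E' x)"
  by (simp add: frame_def bases)

text \<open>By uniqueness of pullbacks, each axiom follows from the corresponding closure property of the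
  pullback relation. The cocycle identities give the composition law and the identity.\<close>

lemma flat_linear_transport_of_matrices:
  fixes H H' :: "'n \<Rightarrow> 'n \<Rightarrow> 'a \<Rightarrow> 'a \<Rightarrow> real"
  assumes comps: "\<And>x y p q C. x \<in> M \<Longrightarrow> y \<in> M \<Longrightarrow>
      L x y (tensor_of_components (T x) (E x) (E' x) p q C) =
      tensor_of_components (T y) (E y) (E' y) p q
        (\<lambda>ks ls. \<Sum>is\<in>multi_indices p. \<Sum>js\<in>multi_indices q.
          (\<Prod>a<p. H (ks ! a) (is ! a) y x) * (\<Prod>b<q. H' (ls ! b) (js ! b) y x) * C is js)"
    and inverse: "\<And>x y i j. x \<in> M \<Longrightarrow> y \<in> M \<Longrightarrow>
      (\<Sum>k\<in>UNIV. H k i y x * H' k j y x) = (if i = j then 1 else 0)"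
    and cocycle: "\<And>x y z i j. x \<in> M \<Longrightarrow> y \<in> M \<Longrightarrow> z \<in> M \<Longrightarrow>
      (\<Sum>k\<in>UNIV. H i k z y * H k j y x) = H i j z x"
    and cocycle': "\<And>x y z i j. x \<in> M \<Longrightarrow> y \<in> M \<Longrightarrow> z \<in> M \<Longrightarrow>
      (\<Sum>k\<in>UNIV. H' i k z y * H' k j y x) = H' i j z x"
    and id: "\<And>x i j. x \<in> M \<Longrightarrow> H i j x x = (if i = j then 1 else 0)"
    and id': "\<And>x i j. x \<in> M \<Longrightarrow> H' i j x x = (if i = j then 1 else 0)"
  shows "flat_linear_transport X \<A> L"
proof -
  define P where "P x y = pull_covector (\<lambda>i j. H i j y x) (E y) (E' x)" for x y
  define Q where "Q x y = pull_vector (\<lambda>i j. H' i j y x) (E' y) (E x)" for x y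
  have change: "frame_change (T x) (E x) (E' x) (T y) (E y) (E' y) (\<lambda>i j. H i j y x) (\<lambda>i j. H' i j y x)"
    if "x \<in> M" "y \<in> M" for x y
    using that by (simp add: frame_change_def frame_change_axioms_def frame_at inverse)
  have L: "is_pullback (T y) (P x y) (Q x y) A (L x y A)"
    if "x \<in> M" "y \<in> M" "A \<in> tensors (T x) p q" for x y A p q
  proof -
    have "A = tensor_of_components (T x) (E x) (E' x) p q
        (\<lambda>is js. form A (map (E' x) is) (map (E x) js))" (is "A = ?A")
      by (rule frame.tensor_eq_components[OF frame_at]) fact+
    moreover have "is_pullback (T y) (P x y) (Q x y) ?A (L x y ?A)"
      unfolding comps[OF that(1,2)] P_def Q_def
      by (rule frame_change.is_pullback_components[OF change[OF that(1,2)]])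
    ultimately show ?thesis by metis
  qed
  have types: "L x y A \<in> tensors (T y) p q" if "x \<in> M" "y \<in> M" "A \<in> tensors (T x) p q" for x y A p q
    using is_pullback_tensors[OF L[OF that] that(3)] .
  have LI: "L x y A = B"
    if "x \<in> M" "y \<in> M" "A \<in> tensors (T x) p q" "is_pullback (T y) (P x y) (Q x y) A B" for x y A B p q
    using is_pullback_unique[OF L[OF that(1-3)] that(4)] .
  have algebra: "L x y ` tensor_algebra (T x) \<subseteq> tensor_algebra (T y)" if "x \<in> M" "y \<in> M" for x y
    using types[OF that] by (fastforce simp: tensor_algebra_def)
  have linear: "L x y (lincomb l A m A') = lincomb l (L x y A) m (L x y A')"
    if "x \<in> M" "y \<in> M" "A \<in> tensors (T x) p q" "A' \<in> tensors (T x) p q" for x y p q A A' l m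
    by (rule LI[OF that(1,2) lincomb_tensors[OF that(3,4)]
          is_pullback_lincomb[OF L[OF that(1,2,3)] L[OF that(1,2,4)] that(3,4)]])
  have product: "L x y (A \<otimes>\<^sub>t B) = L x y A \<otimes>\<^sub>t L x y B"
    if "x \<in> M" "y \<in> M" "A \<in> tensor_algebra (T x)" "B \<in> tensor_algebra (T x)" for x y A B
  proof -
    obtain p q p' q' where "A \<in> tensors (T x) p q" "B \<in> tensors (T x) p' q'"
      using \<open>A \<in> _\<close> \<open>B \<in> _\<close> by (auto simp: tensor_algebra_def)
    then show ?thesis
      using LI[OF that(1,2) tensor_prod_tensors is_pullback_tensor_prod] L[OF that(1,2)] by blast
  qed
  have contraction: "L x y (contraction (T x) r s A) = contraction (T y) r s (L x y A)"
    if xy: "x \<in> M" "y \<in> M" and rs: "r \<le> p" "s \<le> q" and A: "A \<in> tensors (T x) (Suc p) (Suc q)"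
    for x y p q r s A
  proof -
    interpret frame_change "T x" "E x" "E' x" "T y" "E y" "E' y" "\<lambda>i j. H i j y x" "\<lambda>i j. H' i j y x"
      by (rule change[OF xy])
    show ?thesis
      using LI[OF xy contraction_tensors[OF src.subspace_space src.coordinate_system A rs]]
        is_pullback_contraction[OF _ A rs] L[OF xy A]
      by (simp add: P_def Q_def)
  qed
  have compose: "L y z (L x y A) = L x z A"
    if xyz: "x \<in> M" "y \<in> M" "z \<in> M" and A: "A \<in> tensor_algebra (T x)" for x y z A
  proof -
    obtain p q where A: "A \<in> tensors (T x) p q" using A by (auto simp: tensor_algebra_def)
    interpret frame_change "T y" "E y" "E' y" "T z" "E z" "E' z" "\<lambda>i j. H i j z y" "\<lambda>i j. H' i j z y"
      by (rule change[OF xyz(2,3)])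
    have "P x y \<circ> P y z = P x z"
    proof
      fix \<omega>
      show "(P x y \<circ> P y z) \<omega> = P x z \<omega>"
        unfolding P_def comp_def by (rule src.pull_covector_compose[OF cocycle[OF xyz]])
    qed
    moreover have "Q x y \<circ> Q y z = Q x z"
    proof
      fix w
      show "(Q x y \<circ> Q y z) w = Q x z w"
        unfolding Q_def comp_def by (rule src.pull_vector_compose[OF cocycle'[OF xyz]])
    qed
    moreover have "is_pullback (T z) (P x y \<circ> P y z) (Q x y \<circ> Q y z) A (L y z (L x y A))"
      using L[OF xyz(1,2) A] L[OF xyz(2,3) types[OF xyz(1,2) A]]
      by (rule is_pullback_compose) (simp_all add: P_def Q_def pull_covector_in pull_vector_in)
    ultimately show ?thesis using LI[OF xyz(1,3) A] by metis
  qed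
  have identity: "L x x A = A" if x: "x \<in> M" and A: "A \<in> tensor_algebra (T x)" for x A
  proof -
    obtain p q where A: "A \<in> tensors (T x) p q" using A by (auto simp: tensor_algebra_def)
    show ?thesis
      using LI[OF x x A] frame.is_pullback_identity[OF frame_at[OF x] id[OF x] id'[OF x] A]
      by (simp add: P_def Q_def)
  qed
  show ?thesis
    unfolding flat_linear_transport_def Let_def
  proof (intro conjI ballI allI impI)
    fix x y assume xy: "x \<in> M" "y \<in> M"
    show "L x y ` tensor_algebra (T x) \<subseteq> tensor_algebra (T y)" by (rule algebra[OF xy])
    show "L x y ` tensors (T x) p q \<subseteq> tensors (T y) p q" for p q using types[OF xy] by blast
  qed (fact linear product contraction compose identity)+
qed

text \<open>The matrices are read off from the transported basis vectors and covectors. Compatibility with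
  products and linearity extend this to basis tensors and then to all tensors; contracting a basis
  vector with a basis covector relates \<open>H\<close> and \<open>H'\<close>, and transporting a basis vector through an
  intermediate point gives the cocycle law.\<close>

lemma matrices_of_flat_linear_transport:
  assumes flat: "flat_linear_transport X \<A> L"
  defines "H \<equiv> \<lambda>i j y x. form (L x y (vector_tensor (T x) (E x j))) [E' y i] []"
    and "H' \<equiv> \<lambda>i j y x. form (L x y (covector_tensor (T x) (E' x j))) [] [E y i]"
  shows "x \<in> M \<Longrightarrow> y \<in> M \<Longrightarrow>
      L x y (tensor_of_components (T x) (E x) (E' x) p q C) =
      tensor_of_components (T y) (E y) (E' y) p q
        (\<lambda>ks ls. \<Sum>is\<in>multi_indices p. \<Sum>js\<in>multi_indices q.
          (\<Prod>a<p. H (ks ! a) (is ! a) y x) * (\<Prod>b<q. H' (ls ! b) (js ! b) y x) * C is js)"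
    and "x \<in> M \<Longrightarrow> y \<in> M \<Longrightarrow> (\<Sum>k\<in>UNIV. H k i y x * H' k j y x) = (if i = j then 1 else 0)"
    and "x \<in> M \<Longrightarrow> y \<in> M \<Longrightarrow> z \<in> M \<Longrightarrow> (\<Sum>k\<in>UNIV. H i k z y * H k j y x) = H i j z x"
    and "x \<in> M \<Longrightarrow> H i j x x = (if i = j then 1 else 0)"
proof -
  note F1 = flat[unfolded flat_linear_transport_def Let_def, THEN conjunct2]
  note F2 = F1[THEN conjunct2] note F3 = F2[THEN conjunct2] note F4 = F3[THEN conjunct2]
  note F5 = F4[THEN conjunct2]
  have types: "L x y A \<in> tensors (T y) p q" if "x \<in> M" "y \<in> M" "A \<in> tensors (T x) p q" for x y A p q
    using F1[THEN conjunct1] that by blast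
  have linear: "L x y (lincomb l A m A') = lincomb l (L x y A) m (L x y A')"
    if "x \<in> M" "y \<in> M" "A \<in> tensors (T x) p q" "A' \<in> tensors (T x) p q" for x y p q A A' l m
    using F2[THEN conjunct1] that by blast
  have product: "L x y (A \<otimes>\<^sub>t B) = L x y A \<otimes>\<^sub>t L x y B"
    if "x \<in> M" "y \<in> M" "A \<in> tensors (T x) p q" "B \<in> tensors (T x) p' q'" for x y A B p q p' q'
    using F3[THEN conjunct1] that tensors_subset_algebra by blast
  have contraction: "L x y (contraction (T x) r s A) = contraction (T y) r s (L x y A)"
    if "x \<in> M" "y \<in> M" "r \<le> p" "s \<le> q" "A \<in> tensors (T x) (Suc p) (Suc q)" for x y p q r s A
    using F4[THEN conjunct1] that by blast
  have compose: "L y z (L x y A) = L x z A"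
    if "x \<in> M" "y \<in> M" "z \<in> M" "A \<in> tensors (T x) p q" for x y z A p q
    using F5[THEN conjunct1] that tensors_subset_algebra by blast
  have identity: "L x x A = A" if "x \<in> M" "A \<in> tensors (T x) p q" for x A p q
    using F5[THEN conjunct2] that tensors_subset_algebra by blast
  have sums: "L x y (Tensor p q (\<Sum>i\<in>I. c i *\<^sub>R form (A i))) =
      Tensor p q (\<Sum>i\<in>I. c i *\<^sub>R form (L x y (A i)))"
    if xy: "x \<in> M" "y \<in> M" and "finite I" "\<And>i. i \<in> I \<Longrightarrow> A i \<in> tensors (T x) p q"
    for x y p q and I :: "('n list \<times> 'n list) set" and c :: "_ \<Rightarrow> real" and A
    using types[OF xy] linear[OF xy] that(3,4) by (rule linear_on_tensor_sum)
  \<comment> \<open>The unit scalar goes to an idempotent scalar, that is \<open>0\<close> or \<open>1\<close>; the value \<open>0\<close> is excluded since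
    the transport can be reversed.\<close>
  have scalar1: "L x y (scalar_tensor 1) = scalar_tensor 1" if xy: "x \<in> M" "y \<in> M" for x y
  proof -
    let ?s = "scalar_tensor 1 :: ('a, 'n) tangent_vector tensor"
    define c where "c = form (L x y ?s) [] []"
    have s: "?s \<in> tensors (T z) 0 0" for z by (rule scalar_tensor_tensors)
    have Ls: "L x y ?s \<in> tensors (T y) 0 0" by (rule types[OF xy s])
    have Lc: "L x y ?s = scalar_tensor c"
      by (rule tensor_eqI[OF Ls scalar_tensor_tensors]) (simp add: tensor_args_def scalar_tensor_def c_def)
    have "?s \<otimes>\<^sub>t ?s = ?s" by (auto simp: tensor_prod_def scalar_tensor_def fun_eq_iff)
    then have "L x y ?s = L x y ?s \<otimes>\<^sub>t L x y ?s" using product[OF xy s s] by simp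
    then have "form (L x y ?s) [] [] = form (L x y ?s \<otimes>\<^sub>t L x y ?s) [] []" by simp
    then have "c = c * c" by (simp add: c_def tensor_prod_def)
    moreover have "c \<noteq> 0"
    proof
      assume "c = 0"
      then have "lincomb 0 (L x y ?s) 0 (L x y ?s) = L x y ?s"
        unfolding Lc by (auto simp: lincomb_def scalar_tensor_def fun_eq_iff zero_fun_def)
      moreover have "L y x (L x y ?s) = ?s"
        using compose[OF xy(1,2,1) s] identity[OF xy(1) s] by simp
      ultimately have "?s = lincomb 0 ?s 0 ?s"
        using linear[OF xy(2,1) Ls Ls, of 0 0] by simp
      then have "form ?s [] [] = form (lincomb 0 ?s 0 ?s) [] []" by simp
      then show False by (simp add: lincomb_def scalar_tensor_def)
    qed
    ultimately show ?thesis using Lc by simp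
  qed
  have scalar: "L x y (scalar_tensor c) = scalar_tensor c" if xy: "x \<in> M" "y \<in> M" for x y c
  proof -
    have c: "scalar_tensor c = lincomb c (scalar_tensor 1) 0 (scalar_tensor 1)"
      by (auto simp: lincomb_def scalar_tensor_def fun_eq_iff)
    show ?thesis
      unfolding c using linear[OF xy scalar_tensor_tensors scalar_tensor_tensors] scalar1[OF xy] by simp
  qed
  have basis: "form (L x y (basis_tensor (T x) (E x) (E' x) is js)) (map (E' y) ks) (map (E y) ls) =
      (\<Prod>a<length is. H (ks ! a) (is ! a) y x) * (\<Prod>b<length js. H' (ls ! b) (js ! b) y x)"
    if xy: "x \<in> M" "y \<in> M" and len: "length ks = length is" "length ls = length js"
    for x y "is" js ks ls
  proof -
    interpret src: frame "T x" "E x" "E' x" by (rule frame_at[OF xy(1)])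
    interpret tgt: frame "T y" "E y" "E' y" by (rule frame_at[OF xy(2)])
    note covec = covector_tensor_tensors[OF src.subspace_space src.covector_in]
    note vec = vector_tensor_tensors[OF src.vector_in]
    show ?thesis using len
    proof (induction "is" arbitrary: ks)
      case Nil
      then show ?case
      proof (induction js arbitrary: ls)
        case Nil
        then show ?case by (simp add: src.basis_tensor_Nil scalar1[OF xy]) (simp add: scalar_tensor_def)
      next
        case (Cons j js)
        then obtain l ls' where "ls = l # ls'" "length ls' = length js" by (cases ls) auto
        then show ?case
          using Cons.IH[of ls'] Cons.prems types[OF xy covec[of j]]
          unfolding src.basis_tensor_covector product[OF xy covec src.basis_tensor_tensors]
          by (simp add: tensor_prod_def tensors_iff H'_def prod.lessThan_Suc_shift del: prod.lessThan_Suc)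
      qed
    next
      case (Cons i "is")
      then obtain k ks' where "ks = k # ks'" "length ks' = length is" by (cases ks) auto
      then show ?case
        using Cons.IH[of ks'] Cons.prems types[OF xy vec[of i]]
        unfolding src.basis_tensor_vector product[OF xy vec src.basis_tensor_tensors]
        by (simp add: tensor_prod_def tensors_iff H_def prod.lessThan_Suc_shift del: prod.lessThan_Suc)
    qed
  qed
  show "L x y (tensor_of_components (T x) (E x) (E' x) p q C) =
      tensor_of_components (T y) (E y) (E' y) p q
        (\<lambda>ks ls. \<Sum>is\<in>multi_indices p. \<Sum>js\<in>multi_indices q.
          (\<Prod>a<p. H (ks ! a) (is ! a) y x) * (\<Prod>b<q. H' (ls ! b) (js ! b) y x) * C is js)"
    (is "L x y ?A = ?B") if xy: "x \<in> M" "y \<in> M"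
  proof -
    interpret src: frame "T x" "E x" "E' x" by (rule frame_at[OF xy(1)])
    interpret tgt: frame "T y" "E y" "E' y" by (rule frame_at[OF xy(2)])
    let ?I = "multi_indices p \<times> multi_indices q :: ('n list \<times> 'n list) set"
    let ?b = "\<lambda>(is, js). basis_tensor (T x) (E x) (E' x) is js"
    let ?C = "\<lambda>(is, js). C is js"
    have "?A = Tensor p q (\<Sum>i\<in>?I. ?C i *\<^sub>R form (?b i))"
      by (simp add: tensor_of_components_def sum.cartesian_product case_prod_unfold)
    also have "L x y \<dots> = Tensor p q (\<Sum>i\<in>?I. ?C i *\<^sub>R form (L x y (?b i)))"
    proof (rule sums[OF xy])
      fix i assume "i \<in> ?I"
      then show "?b i \<in> tensors (T x) p q"
        using src.basis_tensor_tensors[of "fst i" "snd i"] by (auto simp: multi_indices_def)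
    qed simp
    finally have LA: "L x y ?A = \<dots>" .
    show ?thesis
    proof (rule tgt.tensor_eq_componentsI)
      show "L x y ?A \<in> tensors (T y) p q"
        by (rule types[OF xy src.tensor_of_components_tensors])
      show "?B \<in> tensors (T y) p q"
        by (rule tgt.tensor_of_components_tensors)
      fix ks ls :: "'n list" assume k: "ks \<in> multi_indices p" "ls \<in> multi_indices q"
      have "form (L x y ?A) (map (E' y) ks) (map (E y) ls) =
          (\<Sum>is\<in>multi_indices p. \<Sum>js\<in>multi_indices q. C is js *
            form (L x y (basis_tensor (T x) (E x) (E' x) is js)) (map (E' y) ks) (map (E y) ls))"
        unfolding LA by (simp add: sum_fun_apply sum.cartesian_product case_prod_unfold)
      also have "\<dots> = (\<Sum>is\<in>multi_indices p. \<Sum>js\<in>multi_indices q.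
          (\<Prod>a<p. H (ks ! a) (is ! a) y x) * (\<Prod>b<q. H' (ls ! b) (js ! b) y x) * C is js)"
        using k by (intro sum.cong refl) (simp add: basis[OF xy] multi_indices_def mult.commute)
      finally show "form (L x y ?A) (map (E' y) ks) (map (E y) ls) =
          form ?B (map (E' y) ks) (map (E y) ls)"
        by (simp add: tgt.components_of_tensor_of_components[OF k])
    qed
  qed
  show "(\<Sum>k\<in>UNIV. H k i y x * H' k j y x) = (if i = j then 1 else 0)" if xy: "x \<in> M" "y \<in> M"
  proof -
    interpret src: frame "T x" "E x" "E' x" by (rule frame_at[OF xy(1)])
    interpret tgt: frame "T y" "E y" "E' y" by (rule frame_at[OF xy(2)])
    let ?v = "vector_tensor (T x) (E x i)" and ?w = "covector_tensor (T x) (E' x j)"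
    have v: "?v \<in> tensors (T x) 1 0" by (rule vector_tensor_tensors[OF src.vector_in])
    have w: "?w \<in> tensors (T x) 0 1"
      by (rule covector_tensor_tensors[OF src.subspace_space src.covector_in])
    have "scalar_tensor (\<Sum>k\<in>UNIV. H k i y x * H' k j y x) = contraction (T y) 0 0 (L x y ?v \<otimes>\<^sub>t L x y ?w)"
      unfolding tgt.contraction_tensor_prod[OF types[OF xy v] types[OF xy w]] H_def H'_def ..
    also have "\<dots> = contraction (T y) 0 0 (L x y (?v \<otimes>\<^sub>t ?w))"
      using product[OF xy v w] by simp
    also have "\<dots> = L x y (contraction (T x) 0 0 (?v \<otimes>\<^sub>t ?w))"
      using contraction[OF xy, of 0 0 0 0 "?v \<otimes>\<^sub>t ?w"] tensor_prod_tensors[OF v w] by simp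
    also have "contraction (T x) 0 0 (?v \<otimes>\<^sub>t ?w) = scalar_tensor (if i = j then 1 else 0)"
      unfolding src.contraction_tensor_prod[OF v w]
      by (simp add: if_distrib[of "\<lambda>c. c * _"] cong: if_cong)
    also have "L x y \<dots> = \<dots>" by (rule scalar[OF xy])
    finally have "form (scalar_tensor (\<Sum>k\<in>UNIV. H k i y x * H' k j y x) :: ('a, 'n) tangent_vector tensor) [] [] =
        form (scalar_tensor (if i = j then 1 else 0) :: ('a, 'n) tangent_vector tensor) [] []"
      by (rule arg_cong)
    then show ?thesis by (simp add: scalar_tensor_def)
  qed
  show "(\<Sum>k\<in>UNIV. H i k z y * H k j y x) = H i j z x" if xyz: "x \<in> M" "y \<in> M" "z \<in> M"
  proof -
    interpret src: frame "T x" "E x" "E' x" by (rule frame_at[OF xyz(1)])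
    interpret mid: frame "T y" "E y" "E' y" by (rule frame_at[OF xyz(2)])
    let ?v = "vector_tensor (T x) (E x j)"
    have v: "?v \<in> tensors (T x) 1 0" by (rule vector_tensor_tensors[OF src.vector_in])
    have "L x y ?v = Tensor 1 0 (\<Sum>k\<in>UNIV. H k j y x *\<^sub>R form (vector_tensor (T y) (E y k)))"
      unfolding H_def by (rule mid.vector_tensor_expansion[OF types[OF xyz(1,2) v]])
    then have "L x z ?v = L y z (Tensor 1 0 (\<Sum>k\<in>UNIV. H k j y x *\<^sub>R form (vector_tensor (T y) (E y k))))"
      using compose[OF xyz v] by simp
    also have "\<dots> = Tensor 1 0 (\<Sum>k\<in>UNIV. H k j y x *\<^sub>R form (L y z (vector_tensor (T y) (E y k))))"
      using types[OF xyz(2,3)] linear[OF xyz(2,3)] finite_class.finite_UNIV vector_tensor_tensors[OF mid.vector_in]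
      by (rule linear_on_tensor_sum)
    finally show ?thesis by (simp add: H_def sum_fun_apply mult.commute)
  qed
  show "H i j x x = (if i = j then 1 else 0)" if x: "x \<in> M"
  proof -
    interpret frame "T x" "E x" "E' x" by (rule frame_at[OF x])
    show ?thesis unfolding H_def identity[OF x vector_tensor_tensors[OF vector_in]] by simp
  qed
qed

end


theorem proposition2p4:
  fixes X :: "'a topology" and \<A> :: "('a, 'n::finite) chart set"
    and E :: "'a \<Rightarrow> 'n \<Rightarrow> ('a, 'n) tangent_vector"
    and E' :: "'a \<Rightarrow> 'n \<Rightarrow> ('a, 'n) tangent_vector \<Rightarrow> real"
    and L :: "('a, 'n) transport_map"
  assumes manifold: "differentiable_manifold X \<A>"
    and bases: "\<And>x. x \<in> topspace X \<Longrightarrow> dual_bases (tangent_space \<A> x) (E x) (E' x)"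
    and maps: "\<And>x y. x \<in> topspace X \<Longrightarrow> y \<in> topspace X \<Longrightarrow>
      L x y ` tensor_algebra (tangent_space \<A> x) \<subseteq> tensor_algebra (tangent_space \<A> y)"
  shows "flat_linear_transport X \<A> L \<longleftrightarrow>
    (\<exists>(H :: 'n \<Rightarrow> 'n \<Rightarrow> 'a \<Rightarrow> 'a \<Rightarrow> real) (H' :: 'n \<Rightarrow> 'n \<Rightarrow> 'a \<Rightarrow> 'a \<Rightarrow> real).
      (\<forall>x\<in>topspace X. \<forall>y\<in>topspace X. \<forall>p q. \<forall>T :: 'n list \<Rightarrow> 'n list \<Rightarrow> real.
         L x y (tensor_of_components (tangent_space \<A> x) (E x) (E' x) p q T) =
         tensor_of_components (tangent_space \<A> y) (E y) (E' y) p q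
           (\<lambda>ks ls. \<Sum>is\<in>multi_indices p. \<Sum>js\<in>multi_indices q.
              (\<Prod>a<p. H (ks ! a) (is ! a) y x) * (\<Prod>b<q. H' (ls ! b) (js ! b) y x) * T is js)) \<and>
      (\<forall>x\<in>topspace X. \<forall>y\<in>topspace X. \<forall>i j.
         (\<Sum>k\<in>UNIV. H i k y x * H' j k y x) = (if i = j then 1 else 0)) \<and>
      (\<exists>F :: 'a \<Rightarrow> real ^ 'n ^ 'n. (\<forall>x\<in>topspace X. invertible (F x)) \<and>
         (\<forall>x\<in>topspace X. \<forall>y\<in>topspace X.
            (\<chi> i j. H i j y x) = matrix_inv (F y) ** F x)))"
    (is "?flat \<longleftrightarrow> (\<exists>H H'. ?comps H H' \<and> ?dual H H' \<and> ?factor H)")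
proof -
  interpret framed_manifold X \<A> E E' L by unfold_locales (rule bases)
  show ?thesis
  proof
    assume flat: ?flat
    define H where "H i j y x = form (L x y (vector_tensor (T x) (E x j))) [E' y i] []" for i j y x
    define H' where "H' i j y x = form (L x y (covector_tensor (T x) (E' x j))) [] [E y i]" for i j y x
    note matrices = matrices_of_flat_linear_transport[OF flat, folded H_def H'_def]
    have "?comps H H'" using matrices(1) by blast
    moreover have "?dual H H'"
    proof (intro ballI allI)
      fix x y i j assume xy: "x \<in> topspace X" "y \<in> topspace X"
      \<comment> \<open>The contraction law gives this identity for the transposed matrices, which are square.\<close>
      let ?A = "\<chi> i j. H j i y x" and ?B = "\<chi> i j. H' i j y x"
      have "?A ** ?B = mat 1"
        using matrices(2)[OF xy] by (simp add: matrix_matrix_mult_def mat_def vec_eq_iff)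
      then have "(?B ** ?A) $ j $ i = (mat 1 :: real ^ 'n ^ 'n) $ j $ i"
        by (simp add: matrix_left_right_inverse)
      then show "(\<Sum>k\<in>UNIV. H i k y x * H' j k y x) = (if i = j then 1 else 0)"
        by (auto simp: matrix_matrix_mult_def mat_def mult.commute)
    qed
    moreover have "?factor H" by (rule cocycle_factorization) (use matrices(3,4) in auto)
    ultimately show "\<exists>H H'. ?comps H H' \<and> ?dual H H' \<and> ?factor H" by blast
  next
    assume "\<exists>H H'. ?comps H H' \<and> ?dual H H' \<and> ?factor H"
    then obtain H H' and F :: "'a \<Rightarrow> real ^ 'n ^ 'n" where comps: "?comps H H'"
      and dual: "?dual H H'" and inv: "\<forall>x\<in>topspace X. invertible (F x)"
      and HF: "\<forall>x\<in>topspace X. \<forall>y\<in>topspace X. (\<chi> i j. H i j y x) = matrix_inv (F y) ** F x"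
      by (elim exE conjE) (rule that)
    have cocycle:
      "x \<in> M \<Longrightarrow> y \<in> M \<Longrightarrow> (\<Sum>k\<in>UNIV. H k i y x * H' k j y x) = (if i = j then 1 else 0)"
      "x \<in> M \<Longrightarrow> y \<in> M \<Longrightarrow> z \<in> M \<Longrightarrow> (\<Sum>k\<in>UNIV. H i k z y * H k j y x) = H i j z x"
      "x \<in> M \<Longrightarrow> y \<in> M \<Longrightarrow> z \<in> M \<Longrightarrow> (\<Sum>k\<in>UNIV. H' i k z y * H' k j y x) = H' i j z x"
      "x \<in> M \<Longrightarrow> H i j x x = (if i = j then 1 else 0)"
      "x \<in> M \<Longrightarrow> H' i j x x = (if i = j then 1 else 0)" for x y z i j
      using matrix_cocycle[of M F H H'] inv HF dual by auto
    show ?flat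
      by (rule flat_linear_transport_of_matrices[of H H']) (use comps cocycle in auto)
  qed
qed

end
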